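(* Let $S$ be a bicyclic semigroup, that is, a semigroup with identity $e$ generated by two elements $p$ and $q$ such that $pq=e\neq qp$. Then the semigroup algebra $\ell^1(S)$ is not Johnson pseudo-contractible.
   Context: $\ell^1(S)$ is the complex Banach algebra of absolutely summable functions on $S$ with the $\ell^1$-norm and convolution product (determined by $\delta_s*\delta_t=\delta_{st}$). For a Banach algebra $A$, let $A\otimes_p A$ be the (completed) projective tensor product, a Banach $A$-bimodule with actions determined by $a\cdot(b\otimes c)=ab\otimes c$ and $(b\otimes c)\cdot a=b\otimes ca$, and let $\pi_A:A\otimes_p A\to A$ be the bounded linear map determined by $\pi_A(a\otimes b)=ab$. The biduals $A^{**}$ and $(A\otimes_p A)^{**}$ carry the induced bidual $A$-bimodule structures, and $A$ is regarded as canonically embedded in $A^{**}$. $A$ is called Johnson pseudo-contractible if there is a (not necessarily bounded) net $(m_\alpha)$ in $(A\otimes_p A)^{**}$ such that $a\cdot m_\alpha=m_\alpha\cdot a$ for all $\alpha$ and $\pi_A^{**}(m_\alpha)a-a\to 0$ in norm, for every $a\in A$. *)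

theory Defs
  imports "HOL-Analysis.Analysis"
begin

section \<open>Complex normed spaces and Banach algebras\<close>

text \<open>Complex spaces extend the real ones of the library by a compatible complex scalar
  multiplication; norm, topology and completeness are inherited.\<close>

class complex_normed_vector = real_normed_vector +
  fixes scaleC :: "complex \<Rightarrow> 'a \<Rightarrow> 'a"  (infixr "*\<^sub>C" 75)
  assumes scaleC_add_right: "c *\<^sub>C (x + y) = c *\<^sub>C x + c *\<^sub>C y"
    and scaleC_add_left: "(c + d) *\<^sub>C x = c *\<^sub>C x + d *\<^sub>C x"
    and scaleC_scaleC: "c *\<^sub>C d *\<^sub>C x = (c * d) *\<^sub>C x"
    and scaleC_of_real: "complex_of_real r *\<^sub>C x = r *\<^sub>R x"
    and norm_scaleC: "norm (c *\<^sub>C x) = cmod c * norm x"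

class complex_banach = complex_normed_vector + banach

class complex_banach_algebra = complex_banach + real_normed_algebra +
  assumes mult_scaleC_left: "(c *\<^sub>C x) * y = c *\<^sub>C (x * y)"
    and mult_scaleC_right: "x * (c *\<^sub>C y) = c *\<^sub>C (x * y)"

instantiation complex :: complex_banach_algebra
begin

definition scaleC_complex :: "complex \<Rightarrow> complex \<Rightarrow> complex"
  where [simp]: "scaleC_complex c x = c * x"

instance
  by standard (simp_all add: algebra_simps norm_mult scaleR_conv_of_real)

end

lemma scaleC_one [simp]: "1 *\<^sub>C (x::'a::complex_normed_vector) = x"
  using scaleC_of_real [of 1 x] by simp

lemma scaleC_zero_right [simp]: "c *\<^sub>C (0::'a::complex_normed_vector) = 0"
  using scaleC_add_right [of c "0::'a" 0] by simp

lemma scaleC_minus_right: "c *\<^sub>C (- x::'a::complex_normed_vector) = - (c *\<^sub>C x)"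
  using scaleC_add_right [of c x "- x"] by (simp add: eq_neg_iff_add_eq_0 add.commute)

lemma scaleC_diff_right:
  "c *\<^sub>C (x - y::'a::complex_normed_vector) = c *\<^sub>C x - c *\<^sub>C y"
  using scaleC_add_right [of c x "- y"] by (simp add: scaleC_minus_right)

definition bounded_clinear :: "('a::complex_normed_vector \<Rightarrow> 'b::complex_normed_vector) \<Rightarrow> bool"
  where "bounded_clinear T \<longleftrightarrow> bounded_linear T \<and> (\<forall>c x. T (c *\<^sub>C x) = c *\<^sub>C T x)"

definition bounded_cbilinear ::
    "('a::complex_normed_vector \<Rightarrow> 'b::complex_normed_vector \<Rightarrow> 'c::complex_normed_vector) \<Rightarrow> bool"
  where "bounded_cbilinear B \<longleftrightarrow> bounded_bilinear B \<and>
    (\<forall>c x y. B (c *\<^sub>C x) y = c *\<^sub>C B x y) \<and> (\<forall>c x y. B x (c *\<^sub>C y) = c *\<^sub>C B x y)"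

lemma bounded_clinear_bounded_linear: "bounded_clinear T \<Longrightarrow> bounded_linear T"
  by (simp add: bounded_clinear_def)

lemma bounded_clinear_scaleC: "bounded_clinear T \<Longrightarrow> T (c *\<^sub>C x) = c *\<^sub>C T x"
  by (simp add: bounded_clinear_def)

lemma bounded_clinear_compose:
  "bounded_clinear S \<Longrightarrow> bounded_clinear T \<Longrightarrow> bounded_clinear (\<lambda>x. S (T x))"
  by (simp add: bounded_clinear_def bounded_linear_compose)

lemma bounded_cbilinear_bounded_bilinear: "bounded_cbilinear B \<Longrightarrow> bounded_bilinear B"
  by (simp add: bounded_cbilinear_def)

lemma bounded_cbilinear_compose:
  assumes "bounded_clinear T" "bounded_cbilinear B"
  shows "bounded_cbilinear (\<lambda>x y. T (B x y))"
proof -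
  interpret B: bounded_bilinear B using assms(2) by (rule bounded_cbilinear_bounded_bilinear)
  interpret T: bounded_linear T using assms(1) by (rule bounded_clinear_bounded_linear)
  have "bounded_bilinear (\<lambda>x y. T (B x y))"
  proof
    show "\<exists>K. \<forall>a b. norm (T (B a b)) \<le> norm a * norm b * K"
    proof -
      obtain K where K: "\<And>x. norm (T x) \<le> norm x * K" "K > 0" using T.pos_bounded by blast
      obtain L where L: "\<And>a b. norm (B a b) \<le> norm a * norm b * L" using B.bounded by blast
      have "norm (T (B a b)) \<le> norm a * norm b * (L * K)" for a b
        using order_trans [OF K(1) [of "B a b"] mult_right_mono [OF L [of a b], of K]] K(2)
        by (simp add: mult.assoc)
      then show ?thesis by blast
    qed
  qed (simp_all add: B.add_left B.add_right B.scaleR_left B.scaleR_right T.add T.scaleR)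
  then show ?thesis
    using assms by (simp add: bounded_cbilinear_def bounded_clinear_def)
qed

lemma bounded_cbilinear_mult:
  "bounded_cbilinear ((*) :: 'a::complex_banach_algebra \<Rightarrow> 'a \<Rightarrow> 'a)"
  by (simp add: bounded_cbilinear_def bounded_bilinear_mult mult_scaleC_left mult_scaleC_right)

text \<open>A normed space in which every absolutely convergent series converges is complete.\<close>

lemma Cauchy_convergent_if_abs_summable:
  fixes X :: "nat \<Rightarrow> 'a::real_normed_vector"
  assumes abs: "\<And>f::nat \<Rightarrow> 'a. summable (\<lambda>n. norm (f n)) \<Longrightarrow> summable f"
    and X: "Cauchy X"
  shows "convergent X"
proof -
  have "\<exists>M. \<forall>m\<ge>M. \<forall>n\<ge>M. norm (X m - X n) < (1/2) ^ k" for k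
    using CauchyD [OF X, of "(1/2)^k"] by auto
  then obtain M where M: "\<And>k m n. m \<ge> M k \<Longrightarrow> n \<ge> M k \<Longrightarrow> norm (X m - X n) < (1/2::real) ^ k"
    by metis
  define r where "r = rec_nat (M 0) (\<lambda>k x. max (Suc x) (M (Suc k)))"
  have r_Suc: "r (Suc k) = max (Suc (r k)) (M (Suc k))" for k
    by (simp add: r_def)
  have r0: "r 0 = M 0" by (simp add: r_def)
  have rM: "r k \<ge> M k" for k by (cases k) (simp_all add: r_Suc r0)
  have "strict_mono r" by (simp add: strict_mono_Suc_iff r_Suc less_max_iff_disj)
  have le: "norm (X (r (Suc k)) - X (r k)) \<le> (1/2) ^ k" for k
    using M [of k "r (Suc k)" "r k"] rM [of k] by (simp add: r_Suc less_imp_le)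
  have "summable (\<lambda>k. norm (X (r (Suc k)) - X (r k)))"
    by (rule summable_comparison_test' [where g = "\<lambda>k. (1/2::real) ^ k"]) (use le in auto)
  then have "summable (\<lambda>k. X (r (Suc k)) - X (r k))" by (rule abs)
  moreover have "(\<Sum>k<n. X (r (Suc k)) - X (r k)) = X (r n) - X (r 0)" for n
    by (rule sum_lessThan_telescope)
  ultimately have "convergent (\<lambda>n. X (r n) - X (r 0))"
    by (simp add: summable_iff_convergent)
  then obtain L where L: "(\<lambda>n. X (r n) - X (r 0)) \<longlonglongrightarrow> L" by (auto simp: convergent_def)
  have "(\<lambda>n. X (r n) - X (r 0) + X (r 0)) \<longlonglongrightarrow> L + X (r 0)"
    by (intro tendsto_intros L)
  then have "(X \<circ> r) \<longlonglongrightarrow> L + X (r 0)" by (simp add: o_def)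
  then have "X \<longlonglongrightarrow> L + X (r 0)"
    using X \<open>strict_mono r\<close> by (metis Cauchy_converges_subseq)
  then show ?thesis by (auto simp: convergent_def)
qed

text \<open>A criterion for completeness: the functions \<open>e i\<close> play the role of coordinates.\<close>

lemma Cauchy_convergent_if_coordinatewise:
  fixes X :: "nat \<Rightarrow> 'a::real_normed_vector" and e :: "'i \<Rightarrow> 'a \<Rightarrow> complex"
  assumes lin: "\<And>i. linear (e i)"
    and sep: "\<And>u v. (\<And>i. e i u = e i v) \<Longrightarrow> u = v"
    and sums: "\<And>f::nat \<Rightarrow> 'a. summable (\<lambda>n. norm (f n)) \<Longrightarrow>
      \<exists>g. summable g \<and> (\<forall>n. 0 \<le> g n) \<and> (\<forall>i I. (\<lambda>n. e i (f n)) summable_on I) \<and>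
        (\<forall>I. \<exists>u. (\<forall>i. e i u = (\<Sum>\<^sub>\<infinity>n\<in>I. e i (f n))) \<and> norm u \<le> (\<Sum>\<^sub>\<infinity>n\<in>I. g n))"
    and X: "Cauchy X"
  shows "convergent X"
proof (rule Cauchy_convergent_if_abs_summable [OF _ X])
  fix f :: "nat \<Rightarrow> 'a"
  assume "summable (\<lambda>n. norm (f n))"
  from sums [OF this] obtain g where g: "summable g" and g0: "\<And>n. 0 \<le> g n"
    and sm: "\<And>i I. (\<lambda>n. e i (f n)) summable_on I"
    and ex: "\<And>I. \<exists>u. (\<forall>i. e i u = (\<Sum>\<^sub>\<infinity>n\<in>I. e i (f n))) \<and> norm u \<le> (\<Sum>\<^sub>\<infinity>n\<in>I. g n)"
    by blast
  obtain u where u: "\<And>i. e i u = (\<Sum>\<^sub>\<infinity>n. e i (f n))"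
    using ex [of UNIV] by blast
  have "norm (u - sum f {..<N}) \<le> (\<Sum>n. g (n + N))" for N
  proof -
    obtain v where v: "\<And>i. e i v = (\<Sum>\<^sub>\<infinity>n\<in>{N..}. e i (f n))"
      and nv: "norm v \<le> (\<Sum>\<^sub>\<infinity>n\<in>{N..}. g n)"
      using ex [of "{N..}"] by blast
    have "u = v + sum f {..<N}"
    proof (rule sep)
      fix i
      have split: "{N..} \<union> {..<N} = UNIV" by auto
      have "e i u = (\<Sum>\<^sub>\<infinity>n\<in>{N..} \<union> {..<N}. e i (f n))"
        unfolding split by (rule u)
      also have "\<dots> = (\<Sum>\<^sub>\<infinity>n\<in>{N..}. e i (f n)) + (\<Sum>\<^sub>\<infinity>n\<in>{..<N}. e i (f n))"
        by (rule infsum_Un_disjoint [OF sm sm]) auto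
      also have "\<dots> = e i (v + sum f {..<N})"
        by (simp add: v linear_add [OF lin] linear_sum [OF lin])
      finally show "e i u = e i (v + sum f {..<N})" .
    qed
    moreover have "(\<Sum>\<^sub>\<infinity>n\<in>{N..}. g n) = (\<Sum>n. g (n + N))"
    proof -
      have img: "{N..} = (\<lambda>n. n + N) ` UNIV"
      proof (intro equalityI subsetI)
        fix n assume "n \<in> {N..}"
        then have "n = (n - N) + N" by simp
        then show "n \<in> (\<lambda>n. n + N) ` UNIV" by (rule image_eqI) simp
      qed auto
      have "(\<Sum>\<^sub>\<infinity>n\<in>{N..}. g n) = (\<Sum>\<^sub>\<infinity>n. g (n + N))"
        unfolding img by (subst infsum_reindex) (simp_all add: inj_on_def o_def)
      also have "\<dots> = (\<Sum>n. g (n + N))"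
      proof (rule infsumI, rule sums_nonneg_imp_has_sum)
        show "(\<lambda>n. g (n + N)) sums (\<Sum>n. g (n + N))"
          using g by (intro summable_sums) (simp add: summable_iff_shift)
      qed (rule g0)
      finally show ?thesis .
    qed
    ultimately show ?thesis using nv by simp
  qed
  moreover have "(\<lambda>N. \<Sum>n. g (n + N)) \<longlonglongrightarrow> 0"
    using g by (rule suminf_exist_split2)
  ultimately have "(\<lambda>N. u - sum f {..<N}) \<longlonglongrightarrow> 0"
    by (rule Lim_null_comparison [OF always_eventually [OF allI]])
  from tendsto_diff [OF tendsto_const [of u] this] have "f sums u"
    unfolding sums_def by simp
  then show "summable f" by (rule sums_summable)
qed

section \<open>Topological duals\<close>

typedef (overloaded) 'a dual = "{f::'a::complex_normed_vector \<Rightarrow> complex. bounded_clinear f}"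
  morphisms dual_apply Abs_dual
  by (rule exI [of _ "\<lambda>_. 0"]) (simp add: bounded_clinear_def)

setup_lifting type_definition_dual

instantiation dual :: (complex_normed_vector) complex_normed_vector
begin

lift_definition zero_dual :: "'a dual" is "\<lambda>_. 0"
  by (simp add: bounded_clinear_def)

lift_definition plus_dual :: "'a dual \<Rightarrow> 'a dual \<Rightarrow> 'a dual" is "\<lambda>f g x. f x + g x"
  by (simp add: bounded_clinear_def bounded_linear_add algebra_simps)

lift_definition uminus_dual :: "'a dual \<Rightarrow> 'a dual" is "\<lambda>f x. - f x"
  by (simp add: bounded_clinear_def bounded_linear_minus)

lift_definition minus_dual :: "'a dual \<Rightarrow> 'a dual \<Rightarrow> 'a dual" is "\<lambda>f g x. f x - g x"
  by (simp add: bounded_clinear_def bounded_linear_sub algebra_simps)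

lift_definition scaleR_dual :: "real \<Rightarrow> 'a dual \<Rightarrow> 'a dual" is "\<lambda>r f x. r *\<^sub>R f x"
  by (simp add: bounded_clinear_def bounded_linear_const_scaleR algebra_simps)

lift_definition scaleC_dual :: "complex \<Rightarrow> 'a dual \<Rightarrow> 'a dual" is "\<lambda>c f x. c * f x"
  by (simp add: bounded_clinear_def bounded_linear_const_mult algebra_simps)

lift_definition norm_dual :: "'a dual \<Rightarrow> real" is onorm .

definition sgn_dual :: "'a dual \<Rightarrow> 'a dual" where "sgn_dual f = inverse (norm f) *\<^sub>R f"

definition dist_dual :: "'a dual \<Rightarrow> 'a dual \<Rightarrow> real" where "dist_dual f g = norm (f - g)"

definition uniformity_dual :: "('a dual \<times> 'a dual) filter"
  where "uniformity_dual = (INF e\<in>{0 <..}. principal {(x, y). dist x y < e})"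

definition open_dual :: "'a dual set \<Rightarrow> bool"
  where "open_dual S = (\<forall>x\<in>S. \<forall>\<^sub>F (x', y) in uniformity. x' = x \<longrightarrow> y \<in> S)"

instance
proof
  fix f g h :: "'a dual" and r s :: real and c d :: complex
  show "f + g + h = f + (g + h)" "f + g = g + f" "0 + f = f" "- f + f = 0" "f - g = f + - g"
    "r *\<^sub>R (f + g) = r *\<^sub>R f + r *\<^sub>R g" "(r + s) *\<^sub>R f = r *\<^sub>R f + s *\<^sub>R f"
    "r *\<^sub>R s *\<^sub>R f = (r * s) *\<^sub>R f" "1 *\<^sub>R f = f"
    "c *\<^sub>C (f + g) = c *\<^sub>C f + c *\<^sub>C g" "(c + d) *\<^sub>C f = c *\<^sub>C f + d *\<^sub>C f"
    "c *\<^sub>C d *\<^sub>C f = (c * d) *\<^sub>C f" "complex_of_real r *\<^sub>C f = r *\<^sub>R f"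
    by (transfer, simp add: fun_eq_iff algebra_simps scaleR_conv_of_real)+
  show "dist f g = norm (f - g)" by (rule dist_dual_def)
  show "sgn f = inverse (norm f) *\<^sub>R f" by (rule sgn_dual_def)
  show "(uniformity :: ('a dual \<times> 'a dual) filter) = (INF e\<in>{0 <..}. principal {(x, y). dist x y < e})"
    by (rule uniformity_dual_def)
  show "open S = (\<forall>x\<in>S. \<forall>\<^sub>F (x', y) in uniformity. x' = x \<longrightarrow> y \<in> S)" for S :: "'a dual set"
    by (rule open_dual_def)
  show "(norm f = 0) = (f = 0)"
    by transfer (auto simp: bounded_clinear_def onorm_eq_0)
  show "norm (f + g) \<le> norm f + norm g"
    by transfer (simp add: bounded_clinear_def onorm_triangle)
  show "norm (r *\<^sub>R f) = \<bar>r\<bar> * norm f"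
    by transfer (simp only: bounded_clinear_def onorm_scaleR)
  show "norm (c *\<^sub>C f) = cmod c * norm f"
  proof (transfer, goal_cases)
    case (1 c f)
    have "(SUP x. cmod (c * f x) / norm x) = onorm (\<lambda>x. cmod c *\<^sub>R f x)"
      by (simp add: onorm_def norm_mult)
    then show ?case
      using 1 onorm_scaleR [of f "cmod c"] by (simp add: bounded_clinear_def onorm_def)
  qed
qed

end

lemma dual_bounded_clinear: "bounded_clinear (dual_apply f)"
  using dual_apply by blast

lemma dual_apply_Abs: "bounded_clinear f \<Longrightarrow> dual_apply (Abs_dual f) = f"
  by (simp add: Abs_dual_inverse)

lemma dual_norm_le: "cmod (dual_apply f x) \<le> norm f * norm x"
  by transfer (simp add: bounded_clinear_def onorm)

lemma dual_norm_bound: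
  "0 \<le> b \<Longrightarrow> (\<And>x. cmod (dual_apply f x) \<le> b * norm x) \<Longrightarrow> norm f \<le> b"
  by transfer (rule onorm_bound)

lemmas dual_apply_simps = zero_dual.rep_eq plus_dual.rep_eq uminus_dual.rep_eq
  minus_dual.rep_eq scaleR_dual.rep_eq scaleC_dual.rep_eq

definition dual_map ::
    "('a::complex_normed_vector \<Rightarrow> 'b::complex_normed_vector) \<Rightarrow> 'b dual \<Rightarrow> 'a dual"
  where "dual_map T f = Abs_dual (\<lambda>x. dual_apply f (T x))"

lemma dual_map_apply:
  "bounded_clinear T \<Longrightarrow> dual_apply (dual_map T f) x = dual_apply f (T x)"
  by (simp add: dual_map_def dual_apply_Abs bounded_clinear_compose [OF dual_bounded_clinear])

lemma bounded_clinear_dual_map: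
  assumes "bounded_clinear T"
  shows "bounded_clinear (dual_map T)"
proof -
  note [simp] = dual_map_apply [OF assms] dual_apply_simps
  obtain K where K: "K > 0" "\<And>x. norm (T x) \<le> norm x * K"
    using bounded_linear.pos_bounded [OF bounded_clinear_bounded_linear [OF assms]] by blast
  have "bounded_linear (dual_map T)"
  proof (rule bounded_linear_intro)
    fix f g :: "'b dual" and r :: real
    show "dual_map T (f + g) = dual_map T f + dual_map T g"
      "dual_map T (r *\<^sub>R f) = r *\<^sub>R dual_map T f"
      by (simp_all add: dual_apply_inject [symmetric] fun_eq_iff)
    show "norm (dual_map T f) \<le> norm f * K"
    proof (rule dual_norm_bound)
      show "cmod (dual_apply (dual_map T f) x) \<le> norm f * K * norm x" for x
        using dual_norm_le [of f "T x"] mult_left_mono [OF K(2) [of x], of "norm f"]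
        by (simp add: mult_ac)
    qed (use K in simp)
  qed
  then show ?thesis
    by (simp add: bounded_clinear_def dual_apply_inject [symmetric] fun_eq_iff)
qed

definition to_bidual :: "'a::complex_normed_vector \<Rightarrow> 'a dual dual"
  where "to_bidual x = Abs_dual (\<lambda>f. dual_apply f x)"

lemma to_bidual_apply: "dual_apply (to_bidual x) f = dual_apply f x"
proof -
  have "bounded_linear (\<lambda>f. dual_apply f x)"
    by (rule bounded_linear_intro [where K = "norm x"]) (simp_all add: dual_apply_simps dual_norm_le)
  then show ?thesis
    by (simp add: to_bidual_def dual_apply_Abs bounded_clinear_def dual_apply_simps)
qed

section \<open>The Hahn-Banach theorem\<close>

lemma norming_real_functional:
  fixes x0 :: "'a::real_normed_vector"
  shows "\<exists>f::'a \<Rightarrow> real. linear f \<and> (\<forall>x. \<bar>f x\<bar> \<le> norm x) \<and> f x0 = norm x0"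
proof -
  define \<G> where "\<G> = {G :: ('a \<times> real) set. subspace G \<and> (x0, norm x0) \<in> G \<and> (\<forall>(x, r) \<in> G. r \<le> norm x)}"
  have "span {(x0, norm x0)} \<in> \<G>"
  proof -
    have "k * norm x0 \<le> norm (k *\<^sub>R x0)" for k
      by (simp add: mult_right_mono)
    then have "\<forall>(x, r) \<in> span {(x0, norm x0)}. r \<le> norm x"
      by (auto simp: span_singleton)
    then show ?thesis
      by (simp add: \<G>_def span_base)
  qed
  then have "\<G> \<noteq> {}" by blast
  moreover have "\<Union>\<C> \<in> \<G>" if ne: "\<C> \<noteq> {}" and ch: "subset.chain \<G> \<C>" for \<C>
  proof -
    have sub: "G \<in> \<G>" if "G \<in> \<C>" for G
      using ch that by (auto simp: subset.chain_def)
    have "subspace (\<Union>\<C>)"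
    proof (rule subspaceI)
      show "0 \<in> \<Union>\<C>" using ne sub by (auto simp: \<G>_def subspace_0)
      show "c *\<^sub>R p \<in> \<Union>\<C>" if "p \<in> \<Union>\<C>" for c p
        using that sub by (auto simp: \<G>_def intro: subspace_scale)
      fix p q assume "p \<in> \<Union>\<C>" "q \<in> \<Union>\<C>"
      then obtain G H where GH: "G \<in> \<C>" "H \<in> \<C>" "p \<in> G" "q \<in> H" by blast
      then have "G \<subseteq> H \<or> H \<subseteq> G" using ch by (auto simp: subset.chain_def)
      then obtain K where "K \<in> \<C>" "p \<in> K" "q \<in> K" using GH by blast
      then show "p + q \<in> \<Union>\<C>" using sub by (auto simp: \<G>_def intro: subspace_add)
    qed
    then show ?thesis using ne sub by (fastforce simp: \<G>_def)
  qed
  ultimately obtain G where G: "G \<in> \<G>" and max: "\<And>H. H \<in> \<G> \<Longrightarrow> G \<subseteq> H \<Longrightarrow> H = G"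
    using subset_Zorn_nonempty [of \<G>] by blast
  have sG: "subspace G" and x0: "(x0, norm x0) \<in> G" and bd: "\<And>x r. (x, r) \<in> G \<Longrightarrow> r \<le> norm x"
    using G by (auto simp: \<G>_def)
  have total: "\<exists>r. (y, r) \<in> G" for y
  proof -
    have key: "s - norm (u - y) \<le> norm (v + y) - t" if "(u, s) \<in> G" "(v, t) \<in> G" for u s v t
    proof -
      have "(u + v, s + t) \<in> G" using subspace_add [OF sG that] by simp
      then have "s + t \<le> norm (u + v)" by (rule bd)
      also have "\<dots> \<le> norm (u - y) + norm (v + y)"
        using norm_triangle_ineq [of "u - y" "v + y"] by simp
      finally show ?thesis by simp
    qed
    define L where "L = {s - norm (u - y) |u s. (u, s) \<in> G}"
    define c where "c = Sup L"
    have L0: "L \<noteq> {}" using x0 by (auto simp: L_def)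
    have up: "c \<le> norm (v + y) - t" if "(v, t) \<in> G" for v t
      unfolding c_def using L0 key [OF _ that] by (intro cSup_least) (auto simp: L_def)
    have "bdd_above L"
      using key [OF _ x0] by (auto simp: L_def bdd_above_def)
    then have lo: "s - norm (u - y) \<le> c" if "(u, s) \<in> G" for u s
      unfolding c_def using that by (intro cSup_upper) (auto simp: L_def)
    define H where "H = {(u + k *\<^sub>R y, s + k * c) |u s k. (u, s) \<in> G}"
    have "subspace H"
    proof (rule subspaceI)
      show "0 \<in> H"
        unfolding H_def using subspace_0 [OF sG]
        by (intro CollectI exI [of _ 0]) (simp add: zero_prod_def)
    next
      fix p q assume "p \<in> H" "q \<in> H"
      then obtain u s k where p: "(u, s) \<in> G" "p = (u + k *\<^sub>R y, s + k * c)"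
        by (auto simp: H_def)
      obtain v t l where q: "(v, t) \<in> G" "q = (v + l *\<^sub>R y, t + l * c)"
        using \<open>q \<in> H\<close> by (auto simp: H_def)
      show "p + q \<in> H"
        unfolding H_def using p q subspace_add [OF sG, of "(u, s)" "(v, t)"]
        by (intro CollectI exI [of _ "u + v"] exI [of _ "s + t"] exI [of _ "k + l"])
          (simp add: algebra_simps)
    next
      fix r p assume "p \<in> H"
      then obtain u s k where "(u, s) \<in> G" "p = (u + k *\<^sub>R y, s + k * c)" by (auto simp: H_def)
      then show "r *\<^sub>R p \<in> H"
        unfolding H_def using subspace_scale [OF sG, of "(u, s)" r]
        by (intro CollectI exI [of _ "r *\<^sub>R u"] exI [of _ "r * s"] exI [of _ "r * k"])
          (simp add: algebra_simps)
    qed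
    moreover have sub: "G \<subseteq> H"
    proof
      fix p assume "p \<in> G"
      then show "p \<in> H"
        unfolding H_def by (intro CollectI exI [of _ "fst p"] exI [of _ "snd p"] exI [of _ 0]) simp
    qed
    moreover have H_bd: "s + k * c \<le> norm (u + k *\<^sub>R y)" if us: "(u, s) \<in> G" for u s k
    proof -
      have sc: "(r *\<^sub>R u, r * s) \<in> G" for r using subspace_scale [OF sG us, of r] by simp
      consider "k = 0" | "k > 0" | "k < 0" by linarith
      then show ?thesis
      proof cases
        case 1
        then show ?thesis using bd [OF us] by simp
      next
        case 2
        have "k * c \<le> k * (norm (inverse k *\<^sub>R u + y) - inverse k * s)"
          using up [OF sc] 2 by (intro mult_left_mono) auto
        also have "\<dots> = norm (k *\<^sub>R (inverse k *\<^sub>R u + y)) - s"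
          using 2 by (simp add: right_diff_distrib del: scaleR_add_right scaleR_right_distrib)
        also have "k *\<^sub>R (inverse k *\<^sub>R u + y) = u + k *\<^sub>R y"
          using 2 by (simp add: scaleR_add_right)
        finally show ?thesis by simp
      next
        case 3
        define m where "m = - k"
        have m: "m > 0" using 3 by (simp add: m_def)
        have "m * (inverse m * s - norm (inverse m *\<^sub>R u - y)) \<le> m * c"
          using lo [OF sc] m by (intro mult_left_mono) auto
        also have "m * (inverse m * s - norm (inverse m *\<^sub>R u - y)) = s - norm (m *\<^sub>R (inverse m *\<^sub>R u - y))"
          using m by (simp add: right_diff_distrib)
        also have "m *\<^sub>R (inverse m *\<^sub>R u - y) = u + k *\<^sub>R y"
          using m by (simp add: scaleR_diff_right m_def)
        finally show ?thesis by (simp add: m_def)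
      qed
    qed
    moreover have "\<forall>(x, r) \<in> H. r \<le> norm x"
      using H_bd by (auto simp: H_def)
    ultimately have "H \<in> \<G>"
      using x0 unfolding \<G>_def by blast
    then have "H = G" using sub by (rule max)
    moreover have "(0 + 1 *\<^sub>R y, 0 + 1 * c) \<in> H"
      unfolding H_def using subspace_0 [OF sG] unfolding zero_prod_def by blast
    ultimately show ?thesis by auto
  qed
  have uniq: "r = s" if "(x, r) \<in> G" "(x, s) \<in> G" for x r s
    using bd [of 0 "r - s"] bd [of 0 "s - r"] subspace_diff [OF sG that] subspace_diff [OF sG that(2) that(1)]
    by simp
  define f where "f x = (THE r. (x, r) \<in> G)" for x
  have f: "(x, r) \<in> G \<longleftrightarrow> f x = r" for x r
    unfolding f_def using total [of x] uniq by (metis the_equality)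
  have fG: "(x, f x) \<in> G" for x by (simp add: f)
  have lin: "linear f"
  proof (rule linearI)
    show "f (x + y) = f x + f y" for x y
      using subspace_add [OF sG fG fG, of x y] by (simp add: f)
    show "f (r *\<^sub>R x) = r *\<^sub>R f x" for r x
      using subspace_scale [OF sG fG, of r x] by (simp add: f)
  qed
  have "\<bar>f x\<bar> \<le> norm x" for x
    using bd [OF fG [of x]] bd [OF fG [of "- x"]] linear_neg [OF lin, of x] by simp
  moreover have "f x0 = norm x0" using x0 by (simp add: f)
  ultimately show ?thesis using lin by blast
qed

lemma dual_separates:
  fixes x :: "'a::complex_normed_vector"
  assumes "\<And>f. dual_apply f x = 0"
  shows "x = 0"
proof -
  obtain f :: "'a \<Rightarrow> real" where lin: "linear f" and bd: "\<And>z. \<bar>f z\<bar> \<le> norm z" and fx: "f x = norm x"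
    using norming_real_functional [of x] by blast
  interpret f: linear f by (rule lin)
  define \<phi> where "\<phi> z = Complex (f z) (- f (\<i> *\<^sub>C z))" for z
  have decomp: "c *\<^sub>C z = Re c *\<^sub>R z + Im c *\<^sub>R (\<i> *\<^sub>C z)" for c and z :: 'a
  proof -
    have "c = complex_of_real (Re c) + complex_of_real (Im c) * \<i>"
      by (simp add: complex_eq_iff)
    then have "c *\<^sub>C z = (complex_of_real (Re c) + complex_of_real (Im c) * \<i>) *\<^sub>C z"
      by (rule arg_cong)
    then show ?thesis
      by (simp only: scaleC_add_left scaleC_scaleC [symmetric] scaleC_of_real)
  qed
  have ii: "\<i> *\<^sub>C \<i> *\<^sub>C z = - z" for z :: 'a
    using decomp [of "-1" z] by (simp add: scaleC_scaleC)
  have i_scaleR: "\<i> *\<^sub>C r *\<^sub>R z = r *\<^sub>R \<i> *\<^sub>C z" for r and z :: 'a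
    by (metis mult.commute scaleC_of_real scaleC_scaleC)
  have "bounded_linear \<phi>"
  proof (rule bounded_linear_intro)
    show "\<phi> (u + v) = \<phi> u + \<phi> v" for u v
      by (simp add: \<phi>_def f.add scaleC_add_right complex_eq_iff)
    show "\<phi> (r *\<^sub>R u) = r *\<^sub>R \<phi> u" for r u
      by (simp add: \<phi>_def f.scaleR i_scaleR complex_eq_iff)
    show "norm (\<phi> u) \<le> norm u * 2" for u
      using cmod_le [of "\<phi> u"] bd [of u] bd [of "\<i> *\<^sub>C u"] by (simp add: \<phi>_def norm_scaleC)
  qed
  moreover have "\<phi> (c *\<^sub>C z) = c *\<^sub>C \<phi> z" for c z
    by (simp add: \<phi>_def decomp [of c z] scaleC_add_right i_scaleR ii f.add f.diff f.neg f.scaleR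
        complex_eq_iff)
  ultimately have "bounded_clinear \<phi>" by (simp add: bounded_clinear_def)
  then have "\<phi> x = 0" using assms [of "Abs_dual \<phi>"] by (simp add: dual_apply_Abs)
  then show ?thesis by (simp add: \<phi>_def fx complex_eq_iff)
qed

section \<open>The projective tensor product\<close>

text \<open>An element of the completed projective tensor product is a sum
  \<open>u = (\<Sum>n. x n \<otimes> y n)\<close> with \<open>(\<Sum>n. \<parallel>x n\<parallel> \<parallel>y n\<parallel>) < \<infinity>\<close>, and its norm is the infimum of the latter sums
  over all such representations of \<open>u\<close>. Two series represent the same element iff all bounded
  bilinear forms agree on them, so \<open>u\<close> is encoded as the functional it induces on these forms.
  The type is shown to be complete, and to have the universal property of the projective tensor
  product (\<open>tensor_factor\<close>, \<open>tensor_ext\<close>).\<close>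

typedef (overloaded) ('a, 'b) cform =
    "{B::'a::complex_normed_vector \<Rightarrow> 'b::complex_normed_vector \<Rightarrow> complex. bounded_cbilinear B}"
  morphisms cform_apply Abs_cform
  by (rule exI [of _ "\<lambda>_ _. 0"]) (auto simp: bounded_cbilinear_def bounded_bilinear_def intro!: exI [of _ 0])

lemma cform_bounded_cbilinear: "bounded_cbilinear (cform_apply B)"
  using cform_apply by blast

definition tensor_rep ::
    "(nat \<Rightarrow> 'a::complex_normed_vector) \<Rightarrow> (nat \<Rightarrow> 'b::complex_normed_vector) \<Rightarrow>
      (('a, 'b) cform \<Rightarrow> complex) \<Rightarrow> bool"
  where "tensor_rep x y u \<longleftrightarrow>
    (\<lambda>n. norm (x n) * norm (y n)) summable_on UNIV \<and>
    u = (\<lambda>B. \<Sum>\<^sub>\<infinity>n. cform_apply B (x n) (y n))"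

typedef (overloaded) ('a, 'b) ptensor =
    "{u :: ('a::complex_normed_vector, 'b::complex_normed_vector) cform \<Rightarrow> complex.
       \<exists>x y. tensor_rep x y u}"
  morphisms ptensor_apply Abs_ptensor
  by (rule exI [of _ "\<lambda>B. \<Sum>\<^sub>\<infinity>n::nat. cform_apply B 0 0"])
    (auto simp: tensor_rep_def intro!: exI [of _ "\<lambda>_. 0"])

setup_lifting type_definition_ptensor

lemma cform_bound: "\<exists>K>0. \<forall>x y. cmod (cform_apply B x y) \<le> norm x * norm y * K"
  using bounded_bilinear.pos_bounded [OF bounded_cbilinear_bounded_bilinear [OF cform_bounded_cbilinear]]
  by blast

lemma cform_scaleC:
  "cform_apply B (c *\<^sub>C x) y = c * cform_apply B x y"
  "cform_apply B x (c *\<^sub>C y) = c * cform_apply B x y"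
  using cform_bounded_cbilinear [of B] by (simp_all add: bounded_cbilinear_def)

lemma bilinear_abs_summable:
  assumes "bounded_bilinear B" "(\<lambda>j. norm (x j) * norm (y j)) summable_on J"
  shows "(\<lambda>j. norm (B (x j) (y j))) summable_on J"
proof -
  obtain K where "\<And>x y. norm (B x y) \<le> norm x * norm y * K"
    using bounded_bilinear.bounded [OF assms(1)] by blast
  then show ?thesis
    by (intro Infinite_Sum.abs_summable_on_comparison_test' [OF summable_on_cmult_left [OF assms(2), of K]])
qed

lemma cform_summable:
  assumes "(\<lambda>j. norm (x j) * norm (y j)) summable_on J"
  shows "(\<lambda>j. cform_apply B (x j) (y j)) summable_on J"
  using bilinear_abs_summable [OF bounded_cbilinear_bounded_bilinear [OF cform_bounded_cbilinear] assms]
  by (rule abs_summable_summable)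

lemma tensor_rep_zero: "tensor_rep (\<lambda>_. 0) (\<lambda>_. 0) (\<lambda>_. 0)"
proof -
  have "cform_apply B 0 0 = 0" for B :: "('a, 'b) cform"
    using cform_scaleC(1) [of B 0 0 0] by simp
  then show ?thesis by (simp add: tensor_rep_def)
qed

text \<open>Representations may be indexed by any countable set.\<close>

lemma tensor_repI:
  fixes x :: "'i::countable \<Rightarrow> 'a::complex_normed_vector" and y :: "'i \<Rightarrow> 'b::complex_normed_vector"
  assumes sm: "(\<lambda>j. norm (x j) * norm (y j)) summable_on J"
    and u: "\<And>B. u B = (\<Sum>\<^sub>\<infinity>j\<in>J. cform_apply B (x j) (y j))"
  shows "\<exists>x' y'. tensor_rep x' y' u \<and>
    (\<Sum>\<^sub>\<infinity>n. norm (x' n) * norm (y' n)) = (\<Sum>\<^sub>\<infinity>j\<in>J. norm (x j) * norm (y j))"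
proof -
  define x' where "x' n = (if n \<in> to_nat ` J then x (from_nat n) else 0)" for n
  define y' where "y' n = (if n \<in> to_nat ` J then y (from_nat n) else 0)" for n
  have inj: "inj_on to_nat J" by (rule inj_on_subset [OF inj_to_nat]) simp
  have sm': "(\<lambda>n. norm (x' n) * norm (y' n)) summable_on UNIV"
    and eq: "(\<Sum>\<^sub>\<infinity>n. norm (x' n) * norm (y' n)) = (\<Sum>\<^sub>\<infinity>j\<in>J. norm (x j) * norm (y j))"
  proof -
    have "(\<lambda>n. norm (x' n) * norm (y' n)) summable_on UNIV \<longleftrightarrow>
        (\<lambda>n. norm (x' n) * norm (y' n)) summable_on to_nat ` J"
      by (rule summable_on_cong_neutral) (auto simp: x'_def)
    also have "\<dots> \<longleftrightarrow> (\<lambda>j. norm (x j) * norm (y j)) summable_on J"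
      by (subst summable_on_reindex [OF inj], rule summable_on_cong) (simp add: x'_def y'_def)
    finally show "(\<lambda>n. norm (x' n) * norm (y' n)) summable_on UNIV" using sm by simp
    have "(\<Sum>\<^sub>\<infinity>n. norm (x' n) * norm (y' n)) = (\<Sum>\<^sub>\<infinity>n\<in>to_nat ` J. norm (x' n) * norm (y' n))"
      by (rule infsum_cong_neutral) (auto simp: x'_def)
    also have "\<dots> = (\<Sum>\<^sub>\<infinity>j\<in>J. norm (x j) * norm (y j))"
      by (subst infsum_reindex [OF inj], rule infsum_cong) (simp add: x'_def y'_def)
    finally show "(\<Sum>\<^sub>\<infinity>n. norm (x' n) * norm (y' n)) = (\<Sum>\<^sub>\<infinity>j\<in>J. norm (x j) * norm (y j))" .
  qed
  have "(\<Sum>\<^sub>\<infinity>n. cform_apply B (x' n) (y' n)) = u B" for B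
  proof -
    interpret B: bounded_bilinear "cform_apply B"
      by (rule bounded_cbilinear_bounded_bilinear [OF cform_bounded_cbilinear])
    have "(\<Sum>\<^sub>\<infinity>n. cform_apply B (x' n) (y' n)) = (\<Sum>\<^sub>\<infinity>n\<in>to_nat ` J. cform_apply B (x' n) (y' n))"
      by (rule infsum_cong_neutral) (auto simp: x'_def B.zero_left)
    also have "\<dots> = (\<Sum>\<^sub>\<infinity>j\<in>J. cform_apply B (x j) (y j))"
      by (subst infsum_reindex [OF inj], rule infsum_cong) (simp add: x'_def y'_def)
    finally show ?thesis by (simp add: u)
  qed
  then have "tensor_rep x' y' u" using sm' by (auto simp: tensor_rep_def)
  with eq show ?thesis by blast
qed

lemma tensor_rep_add:
  assumes "tensor_rep x y u" "tensor_rep z w v"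
  shows "\<exists>x' y'. tensor_rep x' y' (\<lambda>B. u B + v B) \<and>
    (\<Sum>\<^sub>\<infinity>n. norm (x' n) * norm (y' n)) =
    (\<Sum>\<^sub>\<infinity>n. norm (x n) * norm (y n)) + (\<Sum>\<^sub>\<infinity>n. norm (z n) * norm (w n))"
proof -
  define X where "X = case_sum x z"
  define Y where "Y = case_sum y w"
  have U: "(UNIV :: (nat + nat) set) = range Inl \<union> range Inr" "range Inl \<inter> range Inr = {}"
    by (auto simp: UNIV_sum)
  have hs: "(h has_sum a + b) (UNIV :: (nat + nat) set)"
    if "((\<lambda>n. h (Inl n)) has_sum a) UNIV" "((\<lambda>n. h (Inr n)) has_sum b) UNIV"
    for h :: "nat + nat \<Rightarrow> 'c::real_normed_vector" and a b
  proof -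
    have "(h has_sum a) (range Inl)" "(h has_sum b) (range Inr)"
      using that by (simp_all add: has_sum_reindex o_def)
    then show ?thesis unfolding U(1) by (rule has_sum_Un_disjoint) (rule U(2))
  qed
  have n: "((\<lambda>j. norm (X j) * norm (Y j)) has_sum
      (\<Sum>\<^sub>\<infinity>n. norm (x n) * norm (y n)) + (\<Sum>\<^sub>\<infinity>n. norm (z n) * norm (w n))) UNIV"
    by (rule hs) (use assms in \<open>simp_all add: X_def Y_def tensor_rep_def\<close>)
  have f: "((\<lambda>j. cform_apply B (X j) (Y j)) has_sum u B + v B) UNIV" for B
    by (rule hs) (use assms in \<open>auto simp add: X_def Y_def tensor_rep_def intro!: has_sum_infsum cform_summable\<close>)
  show ?thesis
    using tensor_repI [OF has_sum_imp_summable [OF n], of "\<lambda>B. u B + v B"]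
    by (simp add: infsumI [OF n] infsumI [OF f])
qed

lemma tensor_rep_scaleC:
  assumes "tensor_rep x y u"
  shows "tensor_rep (\<lambda>n. c *\<^sub>C x n) y (\<lambda>B. c * u B)"
  using assms
  by (simp add: tensor_rep_def norm_scaleC mult.assoc summable_on_cmult_right cform_scaleC
      infsum_cmult_right')

lemma tensor_rep_infsum_scaleC:
  "(\<Sum>\<^sub>\<infinity>n. norm (c *\<^sub>C x n) * norm (y n)) = cmod c * (\<Sum>\<^sub>\<infinity>n. norm (x n) * norm (y n))"
  by (simp add: norm_scaleC mult.assoc infsum_cmult_right')

definition pnorm :: "(('a::complex_normed_vector, 'b::complex_normed_vector) cform \<Rightarrow> complex) \<Rightarrow> real"
  where "pnorm u = Inf {\<Sum>\<^sub>\<infinity>n. norm (x n) * norm (y n) |x y. tensor_rep x y u}"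

lemma pnorm_le:
  assumes "tensor_rep x y u"
  shows "pnorm u \<le> (\<Sum>\<^sub>\<infinity>n. norm (x n) * norm (y n))"
  unfolding pnorm_def
proof (rule cInf_lower)
  show "bdd_below {\<Sum>\<^sub>\<infinity>n. norm (x n) * norm (y n) |x y. tensor_rep x y u}"
    by (auto intro!: bdd_belowI [of _ 0] infsum_nonneg)
qed (use assms in blast)

lemma le_pnorm:
  assumes "tensor_rep x y u"
    and "\<And>x y. tensor_rep x y u \<Longrightarrow> b \<le> (\<Sum>\<^sub>\<infinity>n. norm (x n) * norm (y n))"
  shows "b \<le> pnorm u"
  unfolding pnorm_def by (rule cInf_greatest) (use assms in auto)

lemma pnorm_approx:
  assumes "tensor_rep x y u" "e > 0"
  shows "\<exists>x y. tensor_rep x y u \<and> (\<Sum>\<^sub>\<infinity>n. norm (x n) * norm (y n)) < pnorm u + e"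
proof (rule ccontr)
  assume "\<not> ?thesis"
  then have "pnorm u + e \<le> pnorm u"
    by (intro le_pnorm [OF assms(1)]) (auto simp: not_less)
  then show False using assms(2) by simp
qed

lemma tensor_rep_norm_le:
  assumes rep: "tensor_rep x y u"
    and K: "K \<ge> 0" "\<And>x y. cmod (cform_apply B x y) \<le> norm x * norm y * K"
  shows "cmod (u B) \<le> pnorm u * K"
proof (cases "K = 0")
  case True
  then have "cform_apply B = (\<lambda>_ _. 0)" using K(2) by (auto simp: fun_eq_iff)
  then show ?thesis using rep True by (simp add: tensor_rep_def)
next
  case False
  have "cmod (u B) / K \<le> pnorm u"
  proof (rule le_pnorm [OF rep])
    fix x y assume "tensor_rep x y u"
    then have sm: "(\<lambda>n. norm (x n) * norm (y n)) summable_on UNIV"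
      and u: "u B = (\<Sum>\<^sub>\<infinity>n. cform_apply B (x n) (y n))" by (auto simp: tensor_rep_def)
    have "cmod (u B) \<le> (\<Sum>\<^sub>\<infinity>n. norm (x n) * norm (y n) * K)"
      unfolding u
      by (rule norm_infsum_le [OF has_sum_infsum [OF cform_summable [OF sm]]
            has_sum_infsum [OF summable_on_cmult_left [OF sm]] K(2)])
    also have "\<dots> = (\<Sum>\<^sub>\<infinity>n. norm (x n) * norm (y n)) * K" by (rule infsum_cmult_left')
    finally show "cmod (u B) / K \<le> (\<Sum>\<^sub>\<infinity>n. norm (x n) * norm (y n))"
      using K(1) False by (simp add: divide_le_eq)
  qed
  then show ?thesis using K(1) False by (simp add: divide_le_eq)
qed

lemma pnorm_nonneg: "tensor_rep x y u \<Longrightarrow> 0 \<le> pnorm u"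
  by (rule le_pnorm) (auto intro!: infsum_nonneg)

instantiation ptensor :: (complex_normed_vector, complex_normed_vector) complex_normed_vector
begin

lift_definition zero_ptensor :: "('a, 'b) ptensor" is "\<lambda>_. 0"
  using tensor_rep_zero by blast

lift_definition plus_ptensor :: "('a, 'b) ptensor \<Rightarrow> ('a, 'b) ptensor \<Rightarrow> ('a, 'b) ptensor"
  is "\<lambda>u v B. u B + v B"
  using tensor_rep_add by blast

lift_definition scaleC_ptensor :: "complex \<Rightarrow> ('a, 'b) ptensor \<Rightarrow> ('a, 'b) ptensor"
  is "\<lambda>c u B. c * u B"
  using tensor_rep_scaleC by blast

lift_definition scaleR_ptensor :: "real \<Rightarrow> ('a, 'b) ptensor \<Rightarrow> ('a, 'b) ptensor"
  is "\<lambda>r u B. complex_of_real r * u B"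
  using tensor_rep_scaleC by blast

lift_definition uminus_ptensor :: "('a, 'b) ptensor \<Rightarrow> ('a, 'b) ptensor"
  is "\<lambda>u B. (- 1) * u B"
  using tensor_rep_scaleC by blast

definition minus_ptensor :: "('a, 'b) ptensor \<Rightarrow> ('a, 'b) ptensor \<Rightarrow> ('a, 'b) ptensor"
  where "minus_ptensor u v = u + - v"

lift_definition norm_ptensor :: "('a, 'b) ptensor \<Rightarrow> real" is pnorm .

definition sgn_ptensor :: "('a, 'b) ptensor \<Rightarrow> ('a, 'b) ptensor"
  where "sgn_ptensor u = inverse (norm u) *\<^sub>R u"

definition dist_ptensor :: "('a, 'b) ptensor \<Rightarrow> ('a, 'b) ptensor \<Rightarrow> real"
  where "dist_ptensor u v = norm (u - v)"

definition uniformity_ptensor :: "(('a, 'b) ptensor \<times> ('a, 'b) ptensor) filter"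
  where "uniformity_ptensor = (INF e\<in>{0 <..}. principal {(x, y). dist x y < e})"

definition open_ptensor :: "('a, 'b) ptensor set \<Rightarrow> bool"
  where "open_ptensor S = (\<forall>x\<in>S. \<forall>\<^sub>F (x', y) in uniformity. x' = x \<longrightarrow> y \<in> S)"

instance
proof
  fix u v w :: "('a, 'b) ptensor" and r s :: real and c d :: complex
  show "u + v + w = u + (v + w)" "u + v = v + u" "0 + u = u" "- u + u = 0"
    "r *\<^sub>R (u + v) = r *\<^sub>R u + r *\<^sub>R v" "(r + s) *\<^sub>R u = r *\<^sub>R u + s *\<^sub>R u"
    "r *\<^sub>R s *\<^sub>R u = (r * s) *\<^sub>R u" "1 *\<^sub>R u = u"
    "c *\<^sub>C (u + v) = c *\<^sub>C u + c *\<^sub>C v" "(c + d) *\<^sub>C u = c *\<^sub>C u + d *\<^sub>C u"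
    "c *\<^sub>C d *\<^sub>C u = (c * d) *\<^sub>C u" "complex_of_real r *\<^sub>C u = r *\<^sub>R u"
    by (transfer, simp add: fun_eq_iff algebra_simps)+
  show "u - v = u + - v" by (rule minus_ptensor_def)
  show "dist u v = norm (u - v)" by (rule dist_ptensor_def)
  show "sgn u = inverse (norm u) *\<^sub>R u" by (rule sgn_ptensor_def)
  show "(uniformity :: (('a, 'b) ptensor \<times> ('a, 'b) ptensor) filter) =
      (INF e\<in>{0 <..}. principal {(x, y). dist x y < e})"
    by (rule uniformity_ptensor_def)
  show "open S = (\<forall>x\<in>S. \<forall>\<^sub>F (x', y) in uniformity. x' = x \<longrightarrow> y \<in> S)" for S :: "('a, 'b) ptensor set"
    by (rule open_ptensor_def)
  show "norm (u + v) \<le> norm u + norm v"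
  proof (transfer, goal_cases)
    case (1 u v)
    show ?case
    proof (rule field_le_epsilon)
      fix e :: real assume "e > 0"
      then have e: "e / 2 > 0" by simp
      obtain x y where xy: "tensor_rep x y u" "(\<Sum>\<^sub>\<infinity>n. norm (x n) * norm (y n)) < pnorm u + e / 2"
        using 1 pnorm_approx [OF _ e, of _ _ u] by blast
      obtain z w where zw: "tensor_rep z w v" "(\<Sum>\<^sub>\<infinity>n. norm (z n) * norm (w n)) < pnorm v + e / 2"
        using 1 pnorm_approx [OF _ e, of _ _ v] by blast
      obtain x' y' where x'y': "tensor_rep x' y' (\<lambda>B. u B + v B)"
        "(\<Sum>\<^sub>\<infinity>n. norm (x' n) * norm (y' n)) =
          (\<Sum>\<^sub>\<infinity>n. norm (x n) * norm (y n)) + (\<Sum>\<^sub>\<infinity>n. norm (z n) * norm (w n))"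
        using tensor_rep_add [OF xy(1) zw(1)] by blast
      show "pnorm (\<lambda>B. u B + v B) \<le> pnorm u + pnorm v + e"
        using pnorm_le [OF x'y'(1)] x'y'(2) xy(2) zw(2) by simp
    qed
  qed
  have le: "norm (c *\<^sub>C u) \<le> cmod c * norm u" for c and u :: "('a, 'b) ptensor"
  proof (cases "c = 0")
    case True
    have "norm (0 :: ('a, 'b) ptensor) \<le> 0"
      by transfer (use pnorm_le [OF tensor_rep_zero] in simp)
    moreover have "c *\<^sub>C u = 0" using True by transfer simp
    ultimately show ?thesis using True by simp
  next
    case False
    then show ?thesis
    proof (transfer, goal_cases)
      case (1 c u)
      then obtain x y where rep: "tensor_rep x y u" by blast
      have "pnorm (\<lambda>B. c * u B) / cmod c \<le> pnorm u"
      proof (rule le_pnorm [OF rep])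
        fix x y assume "tensor_rep x y u"
        from pnorm_le [OF tensor_rep_scaleC [OF this, of c]]
        show "pnorm (\<lambda>B. c * u B) / cmod c \<le> (\<Sum>\<^sub>\<infinity>n. norm (x n) * norm (y n))"
          using 1 unfolding tensor_rep_infsum_scaleC by (simp add: divide_le_eq mult.commute)
      qed
      then show ?case using 1 by (simp add: divide_le_eq mult.commute)
    qed
  qed
  show nC: "norm (c *\<^sub>C u) = cmod c * norm u" for c and u :: "('a, 'b) ptensor"
  proof (rule antisym [OF le])
    show "cmod c * norm u \<le> norm (c *\<^sub>C u)"
    proof (cases "c = 0")
      case True
      have "0 \<le> norm (c *\<^sub>C u)" by transfer (use pnorm_nonneg tensor_rep_scaleC in blast)
      then show ?thesis using True by simp
    next
      case False
      have "u = inverse c *\<^sub>C c *\<^sub>C u" using False by transfer (simp add: fun_eq_iff)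
      then have "norm u \<le> inverse (cmod c) * norm (c *\<^sub>C u)"
        using le [of "inverse c" "c *\<^sub>C u"] by (simp add: norm_inverse)
      then show ?thesis using False by (simp add: field_simps)
    qed
  qed
  have "r *\<^sub>R u = complex_of_real r *\<^sub>C u" by transfer simp
  then show "norm (r *\<^sub>R u) = \<bar>r\<bar> * norm u" using nC [of "complex_of_real r" u] by simp
  show "(norm u = 0) = (u = 0)"
  proof
    assume "norm u = 0"
    then show "u = 0"
    proof (transfer, goal_cases)
      case (1 u)
      then obtain x y where "tensor_rep x y u" by blast
      show ?case
      proof
        fix B :: "('a, 'b) cform"
        obtain K where "K > 0" "\<And>x y. cmod (cform_apply B x y) \<le> norm x * norm y * K"
          using cform_bound by blast
        with tensor_rep_norm_le [OF \<open>tensor_rep x y u\<close>, of K B] 1 show "u B = 0" by simp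
      qed
    qed
  next
    assume "u = 0"
    then have "u = 0 *\<^sub>C u" by transfer simp
    then show "norm u = 0" using nC [of 0 u] by simp
  qed
qed

end

lemma ptensor_rep: "\<exists>x y. tensor_rep x y (ptensor_apply u)"
  using ptensor_apply by blast

lemma bounded_linear_ptensor_apply: "bounded_linear (\<lambda>u. ptensor_apply u B)"
proof -
  obtain K where K: "K > 0" "\<And>x y. cmod (cform_apply B x y) \<le> norm x * norm y * K"
    using cform_bound by blast
  show ?thesis
  proof (rule bounded_linear_intro)
    show "norm (ptensor_apply u B) \<le> norm u * K" for u
      using ptensor_rep [of u] tensor_rep_norm_le [of _ _ "ptensor_apply u" K B] K
      by (auto simp: norm_ptensor.rep_eq)
  qed (simp_all add: plus_ptensor.rep_eq scaleR_ptensor.rep_eq scaleR_conv_of_real)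
qed

lemma ptensor_ofI:
  fixes x :: "'i::countable \<Rightarrow> 'a::complex_normed_vector" and y :: "'i \<Rightarrow> 'b::complex_normed_vector"
  assumes "(\<lambda>j. norm (x j) * norm (y j)) summable_on J"
  obtains u where "\<And>B. ptensor_apply u B = (\<Sum>\<^sub>\<infinity>j\<in>J. cform_apply B (x j) (y j))"
    "norm u \<le> (\<Sum>\<^sub>\<infinity>j\<in>J. norm (x j) * norm (y j))"
proof -
  define f where "f B = (\<Sum>\<^sub>\<infinity>j\<in>J. cform_apply B (x j) (y j))" for B
  obtain x' y' where rep: "tensor_rep x' y' f"
    and eq: "(\<Sum>\<^sub>\<infinity>n. norm (x' n) * norm (y' n)) = (\<Sum>\<^sub>\<infinity>j\<in>J. norm (x j) * norm (y j))"
    using tensor_repI [OF assms, of f] by (auto simp: f_def)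
  have "ptensor_apply (Abs_ptensor f) = f" by (rule Abs_ptensor_inverse) (use rep in blast)
  then show thesis
    using that [of "Abs_ptensor f"] pnorm_le [OF rep] eq by (simp add: norm_ptensor.rep_eq f_def)
qed

instance ptensor :: (complex_normed_vector, complex_normed_vector) complex_banach
proof
  fix X :: "nat \<Rightarrow> ('a, 'b) ptensor"
  assume X: "Cauchy X"
  show "convergent X"
  proof (rule Cauchy_convergent_if_coordinatewise [OF _ _ _ X, where e = "\<lambda>B u. ptensor_apply u B"])
    show "linear (\<lambda>u. ptensor_apply u B)" for B :: "('a, 'b) cform"
      by (rule bounded_linear.linear [OF bounded_linear_ptensor_apply])
    show "u = v" if "\<And>B. ptensor_apply u B = ptensor_apply v B" for u v :: "('a, 'b) ptensor"
      using that by (simp add: ptensor_apply_inject [symmetric] fun_eq_iff)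
    fix f :: "nat \<Rightarrow> ('a, 'b) ptensor"
    assume f: "summable (\<lambda>n. norm (f n))"
    have "\<exists>x y. tensor_rep x y (ptensor_apply (f n)) \<and>
        (\<Sum>\<^sub>\<infinity>k. norm (x k) * norm (y k)) < norm (f n) + (1/2) ^ n" for n
      using ptensor_rep [of "f n"] pnorm_approx [of _ _ "ptensor_apply (f n)" "(1/2) ^ n"]
      by (auto simp: norm_ptensor.rep_eq)
    then obtain x y where rep: "\<And>n. tensor_rep (x n) (y n) (ptensor_apply (f n))"
      and le: "\<And>n. (\<Sum>\<^sub>\<infinity>k. norm (x n k) * norm (y n k)) < norm (f n) + (1/2::real) ^ n"
      by metis
    define g where "g n = norm (f n) + (1/2::real) ^ n" for n
    have g: "summable g" unfolding g_def using f by (intro summable_add) auto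
    have g0: "g n \<ge> 0" for n by (simp add: g_def)
    define h where "h p = norm (x (fst p) (snd p)) * norm (y (fst p) (snd p))" for p
    have h_in: "(\<lambda>k. h (n, k)) summable_on UNIV" "(\<Sum>\<^sub>\<infinity>k. h (n, k)) \<le> g n" for n
      using rep [of n] le [of n] by (auto simp: tensor_rep_def h_def g_def)
    have h_pos: "0 \<le> h p" for p by (simp add: h_def)
    have g_on: "g summable_on I" for I
      by (rule summable_on_subset [of _ UNIV]) (use g g0 in \<open>auto simp: summable_on_UNIV_nonneg_real_iff\<close>)
    have hs_on: "(\<lambda>n. \<Sum>\<^sub>\<infinity>k. h (n, k)) summable_on I" for I
      using h_in h_pos by (intro summable_on_comparison_test [OF g_on]) (auto intro: infsum_nonneg)
    have h_on: "h summable_on I \<times> UNIV" for I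
      using h_in h_pos hs_on [of I] by (intro summable_on_SigmaI [where g = "\<lambda>n. \<Sum>\<^sub>\<infinity>k. h (n, k)"]) auto
    have h_le: "(\<Sum>\<^sub>\<infinity>p\<in>I \<times> UNIV. h p) \<le> (\<Sum>\<^sub>\<infinity>n\<in>I. g n)" for I
    proof -
      have "(\<Sum>\<^sub>\<infinity>p\<in>I \<times> UNIV. h p) = (\<Sum>\<^sub>\<infinity>n\<in>I. \<Sum>\<^sub>\<infinity>k. h (n, k))"
        by (rule infsum_Sigma_banach [symmetric]) (rule h_on)
      also have "\<dots> \<le> (\<Sum>\<^sub>\<infinity>n\<in>I. g n)"
        by (rule infsum_mono) (use hs_on g_on h_in in auto)
      finally show ?thesis .
    qed
    have ev: "(\<Sum>\<^sub>\<infinity>p\<in>I \<times> UNIV. cform_apply B (x (fst p) (snd p)) (y (fst p) (snd p))) =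
        (\<Sum>\<^sub>\<infinity>n\<in>I. ptensor_apply (f n) B)" for I B
    proof -
      have "(\<Sum>\<^sub>\<infinity>p\<in>I \<times> UNIV. cform_apply B (x (fst p) (snd p)) (y (fst p) (snd p))) =
          (\<Sum>\<^sub>\<infinity>n\<in>I. \<Sum>\<^sub>\<infinity>k. cform_apply B (x n k) (y n k))"
        using infsum_Sigma_banach [OF cform_summable [OF h_on [unfolded h_def], of B], of I]
        by simp
      then show ?thesis using rep by (simp add: tensor_rep_def)
    qed
    have ev_sm: "(\<lambda>n. ptensor_apply (f n) B) summable_on I" for I B
      using summable_on_Sigma_banach [of "\<lambda>n k. cform_apply B (x n k) (y n k)" I "\<lambda>_. UNIV"]
        cform_summable [OF h_on [unfolded h_def], of B I] rep
      by (simp add: tensor_rep_def case_prod_unfold)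
    have ex: "\<exists>u. (\<forall>B. ptensor_apply u B = (\<Sum>\<^sub>\<infinity>n\<in>I. ptensor_apply (f n) B)) \<and> norm u \<le> (\<Sum>\<^sub>\<infinity>n\<in>I. g n)" for I
    proof -
      obtain u where u: "\<And>B. ptensor_apply u B =
          (\<Sum>\<^sub>\<infinity>p\<in>I \<times> UNIV. cform_apply B (x (fst p) (snd p)) (y (fst p) (snd p)))"
        and nu: "norm u \<le> (\<Sum>\<^sub>\<infinity>p\<in>I \<times> UNIV. norm (x (fst p) (snd p)) * norm (y (fst p) (snd p)))"
        by (rule ptensor_ofI [OF h_on [of I, unfolded h_def]]) blast
      have "\<forall>B. ptensor_apply u B = (\<Sum>\<^sub>\<infinity>n\<in>I. ptensor_apply (f n) B)"
        by (intro allI trans [OF u ev])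
      moreover have "norm u \<le> (\<Sum>\<^sub>\<infinity>n\<in>I. g n)"
        using nu h_le [of I, unfolded h_def] by (rule order_trans)
      ultimately show ?thesis by blast
    qed
    show "\<exists>g. summable g \<and> (\<forall>n. 0 \<le> g n) \<and>
        (\<forall>B I. (\<lambda>n. ptensor_apply (f n) B) summable_on I) \<and>
        (\<forall>I. \<exists>u. (\<forall>B. ptensor_apply u B = (\<Sum>\<^sub>\<infinity>n\<in>I. ptensor_apply (f n) B)) \<and>
          norm u \<le> (\<Sum>\<^sub>\<infinity>n\<in>I. g n))"
      by (intro exI [of _ g] conjI allI g g0 ev_sm ex)
  qed
qed

definition tensor :: "'a::complex_normed_vector \<Rightarrow> 'b::complex_normed_vector \<Rightarrow> ('a, 'b) ptensor"
    (infixr "\<otimes>\<^sub>p" 72)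
  where "a \<otimes>\<^sub>p b = Abs_ptensor (\<lambda>B. cform_apply B a b)"

lemma tensor_apply: "ptensor_apply (a \<otimes>\<^sub>p b) B = cform_apply B a b"
  and norm_tensor_le: "norm (a \<otimes>\<^sub>p b) \<le> norm a * norm b"
proof -
  obtain u where u: "\<And>B. ptensor_apply u B = (\<Sum>\<^sub>\<infinity>j::unit\<in>UNIV. cform_apply B a b)"
    and nu: "norm u \<le> (\<Sum>\<^sub>\<infinity>j::unit\<in>UNIV. norm a * norm b)"
    by (rule ptensor_ofI [where J = "UNIV :: unit set" and x = "\<lambda>_. a" and y = "\<lambda>_. b"])
      (simp, rule that, blast+)
  have "ptensor_apply u = (\<lambda>B. cform_apply B a b)" using u by auto
  then have "u = a \<otimes>\<^sub>p b" by (metis tensor_def ptensor_apply_inverse)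
  with u nu show "ptensor_apply (a \<otimes>\<^sub>p b) B = cform_apply B a b" "norm (a \<otimes>\<^sub>p b) \<le> norm a * norm b"
    by simp_all
qed

lemma ptensor_eqI: "(\<And>B. ptensor_apply u B = ptensor_apply v B) \<Longrightarrow> u = v"
  by (simp add: ptensor_apply_inject [symmetric] fun_eq_iff)

lemma bounded_cbilinear_tensor: "bounded_cbilinear (\<otimes>\<^sub>p)"
proof -
  note [simp] = tensor_apply plus_ptensor.rep_eq scaleR_ptensor.rep_eq scaleC_ptensor.rep_eq
  have bb: "bounded_bilinear (cform_apply B)" for B :: "('a, 'b) cform"
    by (rule bounded_cbilinear_bounded_bilinear [OF cform_bounded_cbilinear])
  have "bounded_bilinear ((\<otimes>\<^sub>p) :: 'a \<Rightarrow> 'b \<Rightarrow> _)"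
  proof
    fix a a' :: 'a and b b' :: 'b and r :: real
    show "(a + a') \<otimes>\<^sub>p b = a \<otimes>\<^sub>p b + a' \<otimes>\<^sub>p b"
      by (rule ptensor_eqI) (simp add: bounded_bilinear.add_left [OF bb])
    show "a \<otimes>\<^sub>p (b + b') = a \<otimes>\<^sub>p b + a \<otimes>\<^sub>p b'"
      by (rule ptensor_eqI) (simp add: bounded_bilinear.add_right [OF bb])
    show "(r *\<^sub>R a) \<otimes>\<^sub>p b = r *\<^sub>R (a \<otimes>\<^sub>p b)"
      by (rule ptensor_eqI) (simp add: bounded_bilinear.scaleR_left [OF bb] scaleR_conv_of_real)
    show "a \<otimes>\<^sub>p (r *\<^sub>R b) = r *\<^sub>R (a \<otimes>\<^sub>p b)"
      by (rule ptensor_eqI) (simp add: bounded_bilinear.scaleR_right [OF bb] scaleR_conv_of_real)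
    show "\<exists>K. \<forall>(a::'a) (b::'b). norm (a \<otimes>\<^sub>p b) \<le> norm a * norm b * K"
      by (rule exI [of _ 1]) (simp add: norm_tensor_le)
  qed
  moreover have "(c *\<^sub>C a) \<otimes>\<^sub>p b = c *\<^sub>C (a \<otimes>\<^sub>p b)" "a \<otimes>\<^sub>p (c *\<^sub>C b) = c *\<^sub>C (a \<otimes>\<^sub>p b)"
    for c and a :: 'a and b :: 'b
    by (rule ptensor_eqI, simp add: cform_scaleC)+
  ultimately show ?thesis by (simp add: bounded_cbilinear_def)
qed

lemma tensor_rep_sums:
  assumes "tensor_rep x y (ptensor_apply u)"
  shows "(\<lambda>n. x n \<otimes>\<^sub>p y n) sums u"
proof -
  have sm: "(\<lambda>n. norm (x n) * norm (y n)) summable_on UNIV"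
    and u: "\<And>B. ptensor_apply u B = (\<Sum>\<^sub>\<infinity>n. cform_apply B (x n) (y n))"
    using assms by (auto simp: tensor_rep_def)
  have "summable (\<lambda>n. x n \<otimes>\<^sub>p y n)"
    by (rule summable_norm_cancel, rule summable_comparison_test' [OF summable_on_imp_summable [OF sm]])
      (simp add: norm_tensor_le)
  then obtain v where v: "(\<lambda>n. x n \<otimes>\<^sub>p y n) sums v" by (auto simp: summable_def)
  have "ptensor_apply v B = ptensor_apply u B" for B
  proof -
    have "(\<lambda>n. cform_apply B (x n) (y n)) sums ptensor_apply v B"
      using bounded_linear.sums [OF bounded_linear_ptensor_apply v] by (simp add: tensor_apply)
    moreover have "(\<lambda>n. cform_apply B (x n) (y n)) sums ptensor_apply u B"
      unfolding u by (intro has_sum_imp_sums has_sum_infsum cform_summable sm)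
    ultimately show ?thesis by (rule sums_unique2)
  qed
  then have "v = u" by (rule ptensor_eqI)
  with v show ?thesis by simp
qed

text \<open>The universal property: bounded bilinear maps factor uniquely through \<open>\<otimes>\<^sub>p\<close>,
  with the same bound.\<close>

lemma tensor_factor:
  fixes \<Phi> :: "'a::complex_normed_vector \<Rightarrow> 'b::complex_normed_vector \<Rightarrow> 'c::complex_banach"
  assumes \<Phi>: "bounded_cbilinear \<Phi>" and K0: "K \<ge> 0" and K: "\<And>a b. norm (\<Phi> a b) \<le> K * (norm a * norm b)"
  shows "\<exists>T. bounded_clinear T \<and> (\<forall>a b. T (a \<otimes>\<^sub>p b) = \<Phi> a b) \<and> (\<forall>u. norm (T u) \<le> K * norm u)"
proof -
  have bb: "bounded_bilinear \<Phi>" using \<Phi> by (rule bounded_cbilinear_bounded_bilinear)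
  define \<beta> where "\<beta> \<phi> = Abs_cform (\<lambda>a b. dual_apply \<phi> (\<Phi> a b))" for \<phi>
  have \<beta>: "cform_apply (\<beta> \<phi>) a b = dual_apply \<phi> (\<Phi> a b)" for \<phi> a b
    unfolding \<beta>_def
    using bounded_cbilinear_compose [OF dual_bounded_clinear \<Phi>] by (simp add: Abs_cform_inverse)
  have bl: "bounded_linear (dual_apply \<phi>)" for \<phi> :: "'c dual"
    by (rule bounded_clinear_bounded_linear [OF dual_bounded_clinear])
  have sep: "c = d" if "\<And>\<phi>. dual_apply \<phi> c = dual_apply \<phi> d" for c d :: 'c
    using dual_separates [of "c - d"] that
    by (simp add: linear_diff [OF bounded_linear.linear [OF bl]])
  define T where "T u = (THE c. \<forall>\<phi>. dual_apply \<phi> c = ptensor_apply u (\<beta> \<phi>))" for u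
  have T_eqI: "T u = c" if "\<And>\<phi>. dual_apply \<phi> c = ptensor_apply u (\<beta> \<phi>)" for u c
    unfolding T_def
  proof (rule the_equality)
    show "d = c" if "\<forall>\<phi>. dual_apply \<phi> d = ptensor_apply u (\<beta> \<phi>)" for d
      by (rule sep) (simp add: that \<open>\<And>\<phi>. dual_apply \<phi> c = ptensor_apply u (\<beta> \<phi>)\<close>)
  qed (use that in blast)
  have T_rep: "T u = (\<Sum>\<^sub>\<infinity>n. \<Phi> (x n) (y n))" if rep: "tensor_rep x y (ptensor_apply u)" for u x y
  proof (rule T_eqI)
    fix \<phi>
    have sm: "(\<lambda>n. norm (x n) * norm (y n)) summable_on UNIV"
      and u: "ptensor_apply u (\<beta> \<phi>) = (\<Sum>\<^sub>\<infinity>n. cform_apply (\<beta> \<phi>) (x n) (y n))"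
      using rep by (auto simp: tensor_rep_def)
    have "(\<lambda>n. \<Phi> (x n) (y n)) summable_on UNIV"
      by (rule abs_summable_summable [OF bilinear_abs_summable [OF bb sm]])
    then have "((\<lambda>n. dual_apply \<phi> (\<Phi> (x n) (y n))) has_sum dual_apply \<phi> (\<Sum>\<^sub>\<infinity>n. \<Phi> (x n) (y n))) UNIV"
      by (intro has_sum_bounded_linear [OF bl] has_sum_infsum)
    then show "dual_apply \<phi> (\<Sum>\<^sub>\<infinity>n. \<Phi> (x n) (y n)) = ptensor_apply u (\<beta> \<phi>)"
      by (simp add: u \<beta> infsumI)
  qed
  have T: "dual_apply \<phi> (T u) = ptensor_apply u (\<beta> \<phi>)" for \<phi> u
  proof -
    obtain x y where rep: "tensor_rep x y (ptensor_apply u)" using ptensor_rep by blast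
    have sm: "(\<lambda>n. norm (x n) * norm (y n)) summable_on UNIV"
      and u: "ptensor_apply u (\<beta> \<phi>) = (\<Sum>\<^sub>\<infinity>n. cform_apply (\<beta> \<phi>) (x n) (y n))"
      using rep by (auto simp: tensor_rep_def)
    have "(\<lambda>n. \<Phi> (x n) (y n)) summable_on UNIV"
      by (rule abs_summable_summable [OF bilinear_abs_summable [OF bb sm]])
    then have "((\<lambda>n. dual_apply \<phi> (\<Phi> (x n) (y n))) has_sum dual_apply \<phi> (\<Sum>\<^sub>\<infinity>n. \<Phi> (x n) (y n))) UNIV"
      by (intro has_sum_bounded_linear [OF bl] has_sum_infsum)
    then show ?thesis
      by (simp add: u \<beta> infsumI T_rep [OF rep])
  qed
  have T_norm: "norm (T u) \<le> K * norm u" for u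
  proof -
    obtain x0 y0 where rep0: "tensor_rep x0 y0 (ptensor_apply u)" using ptensor_rep by blast
    have le: "norm (T u) \<le> K * (\<Sum>\<^sub>\<infinity>n. norm (x n) * norm (y n))"
      if rep: "tensor_rep x y (ptensor_apply u)" for x y
    proof -
      have sm: "(\<lambda>n. norm (x n) * norm (y n)) summable_on UNIV"
        using rep by (simp add: tensor_rep_def)
      have "norm (T u) \<le> (\<Sum>\<^sub>\<infinity>n. K * (norm (x n) * norm (y n)))"
        unfolding T_rep [OF rep]
        by (rule norm_infsum_le [OF has_sum_infsum
              [OF abs_summable_summable [OF bilinear_abs_summable [OF bb sm]]]
              has_sum_infsum [OF summable_on_cmult_right [OF sm]] K])
      then show ?thesis by (simp only: infsum_cmult_right')
    qed
    have "norm (T u) \<le> K * norm u" if "K > 0"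
    proof -
      have "norm (T u) / K \<le> norm u"
        unfolding norm_ptensor.rep_eq
        by (rule le_pnorm [OF rep0]) (use le that in \<open>simp add: divide_le_eq mult.commute\<close>)
      then show ?thesis using that by (simp add: divide_le_eq mult.commute)
    qed
    moreover have "norm (T u) \<le> K * norm u" if "K = 0" using le [OF rep0] that by simp
    ultimately show ?thesis using K0 by fastforce
  qed
  have "bounded_linear T"
  proof (rule bounded_linear_intro [where K = K])
    show "T (u + v) = T u + T v" for u v
      by (rule T_eqI) (simp add: linear_add [OF bounded_linear.linear [OF bl]] T plus_ptensor.rep_eq)
    show "T (r *\<^sub>R u) = r *\<^sub>R T u" for r u
      by (rule T_eqI)
        (simp add: linear_scale [OF bounded_linear.linear [OF bl]] T scaleR_ptensor.rep_eq scaleR_conv_of_real)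
    show "norm (T u) \<le> norm u * K" for u using T_norm [of u] by (simp add: mult.commute)
  qed
  moreover have "T (c *\<^sub>C u) = c *\<^sub>C T u" for c u
    by (rule T_eqI) (simp add: bounded_clinear_scaleC [OF dual_bounded_clinear] T scaleC_ptensor.rep_eq)
  moreover have "T (a \<otimes>\<^sub>p b) = \<Phi> a b" for a b
    by (rule T_eqI) (simp add: tensor_apply \<beta>)
  ultimately show ?thesis using T_norm by (auto simp: bounded_clinear_def)
qed

lemma tensor_ext:
  fixes S T :: "('a::complex_normed_vector, 'b::complex_normed_vector) ptensor \<Rightarrow> 'c::real_normed_vector"
  assumes S: "bounded_linear S" and T: "bounded_linear T"
    and eq: "\<And>a b. S (a \<otimes>\<^sub>p b) = T (a \<otimes>\<^sub>p b)"
  shows "S = T"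
proof
  fix u :: "('a, 'b) ptensor"
  obtain x y where "tensor_rep x y (ptensor_apply u)" using ptensor_rep by blast
  then have u: "(\<lambda>n. x n \<otimes>\<^sub>p y n) sums u" by (rule tensor_rep_sums)
  show "S u = T u"
    using bounded_linear.sums [OF S u] bounded_linear.sums [OF T u] by (simp add: eq sums_unique2)
qed

definition tensor_lift ::
    "('a::complex_normed_vector \<Rightarrow> 'b::complex_normed_vector \<Rightarrow> 'c::complex_banach) \<Rightarrow>
      ('a, 'b) ptensor \<Rightarrow> 'c"
  where "tensor_lift \<Phi> = (THE T. bounded_clinear T \<and> (\<forall>a b. T (a \<otimes>\<^sub>p b) = \<Phi> a b))"

lemma tensor_lift:
  assumes "bounded_cbilinear \<Phi>"
  shows bounded_clinear_tensor_lift: "bounded_clinear (tensor_lift \<Phi>)"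
    and tensor_lift_tensor: "tensor_lift \<Phi> (a \<otimes>\<^sub>p b) = \<Phi> a b"
proof -
  obtain K where "K \<ge> 0" "\<And>a b. norm (\<Phi> a b) \<le> norm a * norm b * K"
    using bounded_bilinear.nonneg_bounded [OF bounded_cbilinear_bounded_bilinear [OF assms]] by blast
  then have "\<exists>T. bounded_clinear T \<and> (\<forall>a b. T (a \<otimes>\<^sub>p b) = \<Phi> a b)"
    using tensor_factor [OF assms, of K] by (auto simp: mult.commute)
  then have "\<exists>!T. bounded_clinear T \<and> (\<forall>a b. T (a \<otimes>\<^sub>p b) = \<Phi> a b)"
    by (metis bounded_clinear_bounded_linear tensor_ext)
  from theI' [OF this] show "bounded_clinear (tensor_lift \<Phi>)" "tensor_lift \<Phi> (a \<otimes>\<^sub>p b) = \<Phi> a b"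
    unfolding tensor_lift_def by blast+
qed

section \<open>The convolution algebra of a semigroup\<close>

typedef 's ell1 = "{f::'s \<Rightarrow> complex. (\<lambda>s. cmod (f s)) summable_on UNIV}"
  morphisms ell1_apply Abs_ell1
  by (rule exI [of _ "\<lambda>_. 0"]) simp

setup_lifting type_definition_ell1

lemma ell1_abs_summable: "(\<lambda>s. cmod (ell1_apply f s)) summable_on I"
  using ell1_apply [of f] by (auto intro: summable_on_subset_banach)

lemma ell1_eqI: "(\<And>s. ell1_apply f s = ell1_apply g s) \<Longrightarrow> f = g"
  by (simp add: ell1_apply_inject [symmetric] fun_eq_iff)

instantiation ell1 :: (type) complex_normed_vector
begin

lift_definition zero_ell1 :: "'s ell1" is "\<lambda>_. 0" by simp

lift_definition plus_ell1 :: "'s ell1 \<Rightarrow> 's ell1 \<Rightarrow> 's ell1" is "\<lambda>f g s. f s + g s"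
  by (rule Infinite_Sum.abs_summable_on_comparison_test' [OF summable_on_add norm_triangle_ineq])

lift_definition uminus_ell1 :: "'s ell1 \<Rightarrow> 's ell1" is "\<lambda>f s. - f s" by simp

lift_definition scaleC_ell1 :: "complex \<Rightarrow> 's ell1 \<Rightarrow> 's ell1" is "\<lambda>c f s. c * f s"
  by (simp add: norm_mult summable_on_cmult_right)

lift_definition scaleR_ell1 :: "real \<Rightarrow> 's ell1 \<Rightarrow> 's ell1" is "\<lambda>r f s. r *\<^sub>R f s"
  by (simp add: summable_on_cmult_right)

definition minus_ell1 :: "'s ell1 \<Rightarrow> 's ell1 \<Rightarrow> 's ell1"
  where "minus_ell1 f g = f + - g"

lift_definition norm_ell1 :: "'s ell1 \<Rightarrow> real" is "\<lambda>f. \<Sum>\<^sub>\<infinity>s. cmod (f s)" .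

definition sgn_ell1 :: "'s ell1 \<Rightarrow> 's ell1" where "sgn_ell1 f = inverse (norm f) *\<^sub>R f"

definition dist_ell1 :: "'s ell1 \<Rightarrow> 's ell1 \<Rightarrow> real" where "dist_ell1 f g = norm (f - g)"

definition uniformity_ell1 :: "('s ell1 \<times> 's ell1) filter"
  where "uniformity_ell1 = (INF e\<in>{0 <..}. principal {(x, y). dist x y < e})"

definition open_ell1 :: "'s ell1 set \<Rightarrow> bool"
  where "open_ell1 S = (\<forall>x\<in>S. \<forall>\<^sub>F (x', y) in uniformity. x' = x \<longrightarrow> y \<in> S)"

instance
proof
  fix f g h :: "'s ell1" and r s :: real and c d :: complex
  show "f + g + h = f + (g + h)" "f + g = g + f" "0 + f = f" "- f + f = 0"
    "r *\<^sub>R (f + g) = r *\<^sub>R f + r *\<^sub>R g" "(r + s) *\<^sub>R f = r *\<^sub>R f + s *\<^sub>R f"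
    "r *\<^sub>R s *\<^sub>R f = (r * s) *\<^sub>R f" "1 *\<^sub>R f = f"
    "c *\<^sub>C (f + g) = c *\<^sub>C f + c *\<^sub>C g" "(c + d) *\<^sub>C f = c *\<^sub>C f + d *\<^sub>C f"
    "c *\<^sub>C d *\<^sub>C f = (c * d) *\<^sub>C f" "complex_of_real r *\<^sub>C f = r *\<^sub>R f"
    by (transfer, simp add: fun_eq_iff algebra_simps scaleR_conv_of_real)+
  show "f - g = f + - g" by (rule minus_ell1_def)
  show "dist f g = norm (f - g)" by (rule dist_ell1_def)
  show "sgn f = inverse (norm f) *\<^sub>R f" by (rule sgn_ell1_def)
  show "(uniformity :: ('s ell1 \<times> 's ell1) filter) = (INF e\<in>{0 <..}. principal {(x, y). dist x y < e})"
    by (rule uniformity_ell1_def)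
  show "open S = (\<forall>x\<in>S. \<forall>\<^sub>F (x', y) in uniformity. x' = x \<longrightarrow> y \<in> S)" for S :: "'s ell1 set"
    by (rule open_ell1_def)
  show "norm (c *\<^sub>C f) = cmod c * norm f"
    by transfer (simp add: norm_mult infsum_cmult_right')
  show "norm (r *\<^sub>R f) = \<bar>r\<bar> * norm f"
    by transfer (simp add: infsum_cmult_right')
  show "norm (f + g) \<le> norm f + norm g"
  proof (transfer, goal_cases)
    case (1 f g)
    have "(\<Sum>\<^sub>\<infinity>s. cmod (f s + g s)) \<le> (\<Sum>\<^sub>\<infinity>s. cmod (f s) + cmod (g s))"
      by (rule infsum_mono [OF Infinite_Sum.abs_summable_on_comparison_test'
            [OF summable_on_add [OF 1]] summable_on_add [OF 1]])
        (rule norm_triangle_ineq)+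
    then show ?case by (simp add: infsum_add [OF 1])
  qed
  show "(norm f = 0) = (f = 0)"
  proof (transfer, rule iffI, goal_cases)
    case (1 f)
    then have "cmod (f s) = 0" for s
      by (intro nonneg_infsum_le_0D [of "\<lambda>s. cmod (f s)" UNIV]) auto
    then show ?case by auto
  qed simp
qed

end

lemma linear_ell1_apply: "linear (\<lambda>f. ell1_apply f s)"
  by (rule linearI) (simp_all add: plus_ell1.rep_eq scaleR_ell1.rep_eq)

lemma ell1_apply_le: "cmod (ell1_apply f s) \<le> norm f"
proof -
  have "(\<Sum>s\<in>{s}. cmod (ell1_apply f s)) \<le> (\<Sum>\<^sub>\<infinity>s. cmod (ell1_apply f s))"
    by (rule finite_sum_le_infsum [OF ell1_abs_summable]) auto
  then show ?thesis by (simp add: norm_ell1.rep_eq)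
qed

instance ell1 :: (type) complex_banach
proof
  fix X :: "nat \<Rightarrow> 's ell1"
  assume X: "Cauchy X"
  show "convergent X"
  proof (rule Cauchy_convergent_if_coordinatewise [OF _ _ _ X, where e = "\<lambda>s f. ell1_apply f s"])
    show "linear (\<lambda>f. ell1_apply f s)" for s :: 's by (rule linear_ell1_apply)
    show "f = g" if "\<And>s. ell1_apply f s = ell1_apply g s" for f g :: "'s ell1"
      using that by (rule ell1_eqI)
    fix f :: "nat \<Rightarrow> 's ell1"
    assume f: "summable (\<lambda>n. norm (f n))"
    have n_on: "(\<lambda>n. norm (f n)) summable_on I" for I
      by (rule summable_on_subset_banach [of _ UNIV]) (use f in \<open>auto simp: summable_on_UNIV_nonneg_real_iff\<close>)
    have sm: "(\<lambda>n. cmod (ell1_apply (f n) s)) summable_on I" for s I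
      by (rule Infinite_Sum.abs_summable_on_comparison_test' [OF n_on]) (rule ell1_apply_le)
    have sm': "(\<lambda>n. ell1_apply (f n) s) summable_on I" for s I
      by (rule abs_summable_summable [OF sm])
    have ex: "\<exists>u. (\<forall>s. ell1_apply u s = (\<Sum>\<^sub>\<infinity>n\<in>I. ell1_apply (f n) s)) \<and> norm u \<le> (\<Sum>\<^sub>\<infinity>n\<in>I. norm (f n))" for I
    proof -
      define h where "h p = cmod (ell1_apply (f (fst p)) (snd p))" for p
      have h: "h summable_on I \<times> UNIV"
      proof (rule summable_on_SigmaI [where g = "\<lambda>n. norm (f n)"])
        show "((\<lambda>s. h (n, s)) has_sum norm (f n)) UNIV" for n
          unfolding h_def norm_ell1.rep_eq using has_sum_infsum [OF ell1_abs_summable] by simp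
      qed (simp_all add: n_on h_def)
      have h_sum: "(\<Sum>\<^sub>\<infinity>n\<in>I. norm (f n)) = (\<Sum>\<^sub>\<infinity>p\<in>I \<times> UNIV. h p)"
        unfolding infsum_Sigma_banach [OF h, symmetric] by (simp add: h_def norm_ell1.rep_eq)
      have h': "(\<lambda>(s, n). h (n, s)) summable_on UNIV \<times> I"
        using h by (simp add: summable_on_swap [of h])
      have h_sum': "(\<Sum>\<^sub>\<infinity>p\<in>I \<times> UNIV. h p) = (\<Sum>\<^sub>\<infinity>s. \<Sum>\<^sub>\<infinity>n\<in>I. h (n, s))"
        using infsum_Sigma_banach [OF h] infsum_swap_banach [of "\<lambda>n s. h (n, s)" I UNIV] h by simp
      have in_sm: "(\<lambda>s. \<Sum>\<^sub>\<infinity>n\<in>I. h (n, s)) summable_on UNIV"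
        using summable_on_Sigma_banach [OF h'] by simp
      define k where "k s = (\<Sum>\<^sub>\<infinity>n\<in>I. ell1_apply (f n) s)" for s
      have k_le: "cmod (k s) \<le> (\<Sum>\<^sub>\<infinity>n\<in>I. h (n, s))" for s
        unfolding k_def h_def using norm_infsum_bound [OF sm [of s I]] by simp
      have k: "(\<lambda>s. cmod (k s)) summable_on UNIV"
        by (rule Infinite_Sum.abs_summable_on_comparison_test' [OF in_sm k_le])
      have ap: "ell1_apply (Abs_ell1 k) = k" using k by (simp add: Abs_ell1_inverse)
      have "(\<Sum>\<^sub>\<infinity>s. cmod (k s)) \<le> (\<Sum>\<^sub>\<infinity>n\<in>I. norm (f n))"
        unfolding h_sum h_sum' by (rule infsum_mono [OF k in_sm k_le])
      then have "norm (Abs_ell1 k) \<le> (\<Sum>\<^sub>\<infinity>n\<in>I. norm (f n))" by (simp add: norm_ell1.rep_eq ap)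
      then show ?thesis by (intro exI [of _ "Abs_ell1 k"]) (simp add: ap k_def)
    qed
    show "\<exists>g. summable g \<and> (\<forall>n. 0 \<le> g n) \<and> (\<forall>s I. (\<lambda>n. ell1_apply (f n) s) summable_on I) \<and>
        (\<forall>I. \<exists>u. (\<forall>s. ell1_apply u s = (\<Sum>\<^sub>\<infinity>n\<in>I. ell1_apply (f n) s)) \<and> norm u \<le> (\<Sum>\<^sub>\<infinity>n\<in>I. g n))"
      by (intro exI [of _ "\<lambda>n. norm (f n)"] conjI allI f norm_ge_zero sm' ex)
  qed
qed

text \<open>Summation along the fibres of a map.\<close>

lemma infsum_fibres:
  fixes h :: "'i \<Rightarrow> 'c::banach"
  assumes h: "h summable_on A" and p: "p ` A \<subseteq> T"
  shows infsum_fibres_eq: "(\<Sum>\<^sub>\<infinity>t\<in>T. \<Sum>\<^sub>\<infinity>i\<in>{i\<in>A. p i = t}. h i) = (\<Sum>\<^sub>\<infinity>i\<in>A. h i)"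
    and summable_on_fibres: "(\<lambda>t. \<Sum>\<^sub>\<infinity>i\<in>{i\<in>A. p i = t}. h i) summable_on T"
proof -
  have inj: "inj_on (\<lambda>i. (p i, i)) A" by (auto simp: inj_on_def)
  have img: "(\<lambda>i. (p i, i)) ` A = Sigma T (\<lambda>t. {i\<in>A. p i = t})" using p by auto
  have sm: "(\<lambda>(t, i). h i) summable_on Sigma T (\<lambda>t. {i\<in>A. p i = t})"
    unfolding img [symmetric] by (subst summable_on_reindex [OF inj]) (simp add: o_def h)
  have "(\<Sum>\<^sub>\<infinity>t\<in>T. \<Sum>\<^sub>\<infinity>i\<in>{i\<in>A. p i = t}. h i) = (\<Sum>\<^sub>\<infinity>(t, i)\<in>Sigma T (\<lambda>t. {i\<in>A. p i = t}). h i)"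
    by (rule infsum_Sigma'_banach [OF sm])
  also have "\<dots> = (\<Sum>\<^sub>\<infinity>i\<in>A. h i)"
    unfolding img [symmetric] by (subst infsum_reindex [OF inj]) (simp add: o_def)
  finally show "(\<Sum>\<^sub>\<infinity>t\<in>T. \<Sum>\<^sub>\<infinity>i\<in>{i\<in>A. p i = t}. h i) = (\<Sum>\<^sub>\<infinity>i\<in>A. h i)" .
  show "(\<lambda>t. \<Sum>\<^sub>\<infinity>i\<in>{i\<in>A. p i = t}. h i) summable_on T"
    by (rule summable_on_Sigma_banach [OF sm])
qed

lemma ell1_product_summable:
  "(\<lambda>(r, s). cmod (ell1_apply f r) * cmod (ell1_apply g s)) summable_on UNIV"
proof -
  have "(\<lambda>p. cmod (ell1_apply f (fst p)) * cmod (ell1_apply g (snd p))) summable_on UNIV \<times> UNIV"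
  proof (rule summable_on_SigmaI [where g = "\<lambda>r. cmod (ell1_apply f r) * norm g"])
    show "((\<lambda>s. cmod (ell1_apply f (fst (r, s))) * cmod (ell1_apply g (snd (r, s)))) has_sum
        cmod (ell1_apply f r) * norm g) UNIV" for r
      unfolding norm_ell1.rep_eq fst_conv snd_conv
      by (intro has_sum_cmult_right has_sum_infsum ell1_abs_summable)
  qed (simp_all add: summable_on_cmult_left ell1_abs_summable)
  then show ?thesis by (simp add: case_prod_unfold)
qed

lemma ell1_product_summable_on:
  "(\<lambda>(r, s). ell1_apply f r * ell1_apply g s) summable_on A"
  "(\<lambda>(r, s). cmod (ell1_apply f r * ell1_apply g s)) summable_on A"
proof -
  show *: "(\<lambda>(r, s). cmod (ell1_apply f r * ell1_apply g s)) summable_on A"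
    by (rule summable_on_subset_banach [OF _ subset_UNIV])
      (use ell1_product_summable [of f g] in \<open>simp add: norm_mult\<close>)
  show "(\<lambda>(r, s). ell1_apply f r * ell1_apply g s) summable_on A"
    by (rule abs_summable_summable) (use * in \<open>simp add: case_prod_unfold\<close>)
qed

lemma ell1_convolution:
  fixes f g :: "'s::semigroup_mult ell1"
  defines "k \<equiv> \<lambda>t. \<Sum>\<^sub>\<infinity>(r, s)\<in>{(r, s). r * s = t}. ell1_apply f r * ell1_apply g s"
  shows "(\<lambda>t. cmod (k t)) summable_on UNIV" "(\<Sum>\<^sub>\<infinity>t. cmod (k t)) \<le> norm f * norm g"
proof -
  define h where "h = (\<lambda>(r, s). cmod (ell1_apply f r * ell1_apply g s))"
  define p where "p = (\<lambda>(r, s). r * s :: 's)"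
  have set_eq: "{(r, s). r * s = t} = {i \<in> UNIV. p i = t}" for t
    by (auto simp: p_def)
  have h: "h summable_on UNIV"
    unfolding h_def by (rule ell1_product_summable_on)
  have k_le: "cmod (k t) \<le> (\<Sum>\<^sub>\<infinity>i\<in>{i \<in> UNIV. p i = t}. h i)" for t
    unfolding k_def set_eq h_def
    using norm_infsum_bound [of "\<lambda>(r, s). ell1_apply f r * ell1_apply g s" "{i \<in> UNIV. p i = t}"]
      ell1_product_summable_on(2) [of f g "{i \<in> UNIV. p i = t}"]
    by (simp add: case_prod_unfold)
  have sm: "(\<lambda>t. \<Sum>\<^sub>\<infinity>i\<in>{i \<in> UNIV. p i = t}. h i) summable_on UNIV"
    by (rule summable_on_fibres [OF h subset_UNIV])
  show k: "(\<lambda>t. cmod (k t)) summable_on UNIV"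
    by (rule Infinite_Sum.abs_summable_on_comparison_test' [OF sm k_le])
  have "(\<Sum>\<^sub>\<infinity>t. cmod (k t)) \<le> (\<Sum>\<^sub>\<infinity>t. \<Sum>\<^sub>\<infinity>i\<in>{i \<in> UNIV. p i = t}. h i)"
    by (rule infsum_mono [OF k sm k_le])
  also have "\<dots> = (\<Sum>\<^sub>\<infinity>i. h i)" by (rule infsum_fibres_eq [OF h subset_UNIV])
  also have "\<dots> = (\<Sum>\<^sub>\<infinity>r. \<Sum>\<^sub>\<infinity>s. h (r, s))"
    using infsum_Sigma_banach [of h UNIV "\<lambda>_. UNIV"] h by simp
  also have "\<dots> = norm f * norm g"
    by (simp add: h_def norm_mult infsum_cmult_right' infsum_cmult_left' norm_ell1.rep_eq)
  finally show "(\<Sum>\<^sub>\<infinity>t. cmod (k t)) \<le> norm f * norm g" .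
qed

instantiation ell1 :: (semigroup_mult) complex_banach_algebra
begin

definition times_ell1 :: "'a ell1 \<Rightarrow> 'a ell1 \<Rightarrow> 'a ell1"
  where "times_ell1 f g =
    Abs_ell1 (\<lambda>t. \<Sum>\<^sub>\<infinity>(r, s)\<in>{(r, s). r * s = t}. ell1_apply f r * ell1_apply g s)"

lemma ell1_apply_times:
  "ell1_apply (f * g) t = (\<Sum>\<^sub>\<infinity>(r, s)\<in>{(r, s). r * s = t}. ell1_apply f r * ell1_apply g s)"
  by (simp add: times_ell1_def Abs_ell1_inverse ell1_convolution)

lemma ell1_mult_assoc: "f * g * k = f * (g * k)" for f g k :: "'a ell1"
proof (rule ell1_eqI)
  fix t :: 'a
  define H where "H = (\<lambda>(q, r, s). ell1_apply f q * ell1_apply g r * ell1_apply k s)"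
  define A where "A = {(q, r, s). q * r * s = t}"
  define C where "C = (\<Sum>\<^sub>\<infinity>(r, s). cmod (ell1_apply g r) * cmod (ell1_apply k s))"
  have "(\<lambda>x. cmod (H x)) summable_on UNIV \<times> UNIV"
  proof (rule summable_on_SigmaI [where g = "\<lambda>q. cmod (ell1_apply f q) * C"])
    fix q
    have eq: "cmod (H (q, y)) =
        cmod (ell1_apply f q) * (case y of (r, s) \<Rightarrow> cmod (ell1_apply g r) * cmod (ell1_apply k s))" for y
      by (cases y) (simp add: H_def norm_mult)
    show "((\<lambda>y. cmod (H (q, y))) has_sum cmod (ell1_apply f q) * C) UNIV"
      unfolding eq C_def by (rule has_sum_cmult_right [OF has_sum_infsum [OF ell1_product_summable]])
  next
    show "(\<lambda>q. cmod (ell1_apply f q) * C) summable_on UNIV"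
      by (rule summable_on_cmult_left [OF ell1_abs_summable])
  qed (rule norm_ge_zero)
  then have "H summable_on UNIV \<times> UNIV" by (rule abs_summable_summable)
  then have "H summable_on UNIV" by (simp only: UNIV_Times_UNIV)
  then have H: "H summable_on A" by (rule summable_on_subset_banach) simp
  define p1 where "p1 = (\<lambda>(q, r, s :: 'a). (q * r :: 'a, s))"
  define p2 where "p2 = (\<lambda>(q :: 'a, r, s). (q, r * s :: 'a))"
  have "ell1_apply (f * g * k) t = (\<Sum>\<^sub>\<infinity>(w, s)\<in>{(w, s). w * s = t}. ell1_apply (f * g) w * ell1_apply k s)"
    by (rule ell1_apply_times)
  also have "\<dots> = (\<Sum>\<^sub>\<infinity>j\<in>{(w, s). w * s = t}. \<Sum>\<^sub>\<infinity>i\<in>{i \<in> A. p1 i = j}. H i)"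
  proof (rule infsum_cong)
    fix j assume "j \<in> {(w, s). w * s = t}"
    then obtain w s where j: "j = (w, s)" "w * s = t" by auto
    have inj: "inj_on (\<lambda>(q, r). (q, r, s)) {(q, r). q * r = w}" by (auto simp: inj_on_def)
    have img: "{i \<in> A. p1 i = j} = (\<lambda>(q, r). (q, r, s)) ` {(q, r). q * r = w}"
      using j by (auto simp: A_def p1_def)
    have "(\<Sum>\<^sub>\<infinity>i\<in>{i \<in> A. p1 i = j}. H i) =
        (\<Sum>\<^sub>\<infinity>(q, r)\<in>{(q, r). q * r = w}. ell1_apply f q * ell1_apply g r * ell1_apply k s)"
      unfolding img by (subst infsum_reindex [OF inj]) (simp add: H_def o_def case_prod_unfold)
    also have "\<dots> = ell1_apply (f * g) w * ell1_apply k s"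
      by (simp add: ell1_apply_times case_prod_unfold infsum_cmult_left')
    finally show "(case j of (w, s) \<Rightarrow> ell1_apply (f * g) w * ell1_apply k s) =
        (\<Sum>\<^sub>\<infinity>i\<in>{i \<in> A. p1 i = j}. H i)" by (simp add: j)
  qed
  also have "\<dots> = (\<Sum>\<^sub>\<infinity>i\<in>A. H i)"
    by (rule infsum_fibres_eq [OF H]) (auto simp: A_def p1_def)
  also have "\<dots> = (\<Sum>\<^sub>\<infinity>j\<in>{(q, w). q * w = t}. \<Sum>\<^sub>\<infinity>i\<in>{i \<in> A. p2 i = j}. H i)"
    by (rule infsum_fibres_eq [OF H, symmetric]) (auto simp: A_def p2_def mult.assoc)
  also have "\<dots> = (\<Sum>\<^sub>\<infinity>(q, w)\<in>{(q, w). q * w = t}. ell1_apply f q * ell1_apply (g * k) w)"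
  proof (rule infsum_cong)
    fix j assume "j \<in> {(q, w). q * w = t}"
    then obtain q w where j: "j = (q, w)" "q * w = t" by auto
    have inj: "inj_on (Pair q) {(r, s). r * s = w}" by (auto simp: inj_on_def)
    have img: "{i \<in> A. p2 i = j} = Pair q ` {(r, s). r * s = w}"
      using j by (auto simp: A_def p2_def mult.assoc)
    have "(\<Sum>\<^sub>\<infinity>i\<in>{i \<in> A. p2 i = j}. H i) =
        (\<Sum>\<^sub>\<infinity>(r, s)\<in>{(r, s). r * s = w}. ell1_apply f q * (ell1_apply g r * ell1_apply k s))"
      unfolding img by (subst infsum_reindex [OF inj]) (simp add: H_def o_def case_prod_unfold mult.assoc)
    also have "\<dots> = ell1_apply f q * ell1_apply (g * k) w"
      by (simp add: ell1_apply_times case_prod_unfold infsum_cmult_right')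
    finally show "(\<Sum>\<^sub>\<infinity>i\<in>{i \<in> A. p2 i = j}. H i) =
        (case j of (q, w) \<Rightarrow> ell1_apply f q * ell1_apply (g * k) w)" by (simp add: j)
  qed
  also have "\<dots> = ell1_apply (f * (g * k)) t" by (rule ell1_apply_times [symmetric])
  finally show "ell1_apply (f * g * k) t = ell1_apply (f * (g * k)) t" .
qed

instance
proof
  fix f g k :: "'a ell1" and r :: real and c :: complex
  note [simp] = ell1_apply_times plus_ell1.rep_eq scaleR_ell1.rep_eq scaleC_ell1.rep_eq
    case_prod_unfold
  have sm: "(\<lambda>p. ell1_apply f (fst p) * ell1_apply g (snd p)) summable_on A" for f g :: "'a ell1" and A
    using ell1_product_summable_on(1) [of f g A] by simp
  show "f * g * k = f * (g * k)" by (rule ell1_mult_assoc)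
  show "(f + g) * k = f * k + g * k"
    by (rule ell1_eqI) (simp add: distrib_right infsum_add sm)
  show "f * (g + k) = f * g + f * k"
    by (rule ell1_eqI) (simp add: distrib_left infsum_add sm)
  show "r *\<^sub>R f * g = r *\<^sub>R (f * g)"
    by (rule ell1_eqI) (simp add: scaleR_conv_of_real mult.assoc infsum_cmult_right')
  show "f * r *\<^sub>R g = r *\<^sub>R (f * g)"
    by (rule ell1_eqI) (simp add: scaleR_conv_of_real mult.left_commute [of _ "complex_of_real r"] infsum_cmult_right')
  show "c *\<^sub>C f * g = c *\<^sub>C (f * g)"
    by (rule ell1_eqI) (simp add: mult.assoc infsum_cmult_right')
  show "f * c *\<^sub>C g = c *\<^sub>C (f * g)"
    by (rule ell1_eqI) (simp add: mult.left_commute [of _ c] infsum_cmult_right')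
  show "norm (f * g) \<le> norm f * norm g"
    using ell1_convolution(2) [of f g] by (simp add: norm_ell1.rep_eq [of "f * g"])
qed

end

lift_definition ell1_delta :: "'s \<Rightarrow> 's ell1" is "\<lambda>s t. of_bool (t = s)"
  by (rule finite_nonzero_values_imp_summable_on) simp

lemma ell1_delta_mult: "ell1_delta s * ell1_delta t = ell1_delta (s * t)"
proof (rule ell1_eqI)
  fix x
  have "ell1_apply (ell1_delta s * ell1_delta t) x =
      (\<Sum>\<^sub>\<infinity>p\<in>{(r, r'). r * r' = x} \<inter> {(s, t)}. 1)"
    unfolding ell1_apply_times ell1_delta.rep_eq
    by (rule infsum_cong_neutral) (auto simp: case_prod_unfold)
  also have "\<dots> = ell1_apply (ell1_delta (s * t)) x"
    by (auto simp: ell1_delta.rep_eq)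
  finally show "ell1_apply (ell1_delta s * ell1_delta t) x = ell1_apply (ell1_delta (s * t)) x" .
qed

section \<open>Johnson pseudo-contractibility\<close>

lemma bounded_clinear_ident: "bounded_clinear (\<lambda>x. x)"
  by (simp add: bounded_clinear_def)

lemma bounded_clinear_mult_left: "bounded_clinear (\<lambda>x::'a::complex_banach_algebra. x * a)"
  by (simp add: bounded_clinear_def bounded_linear_mult_left mult_scaleC_left)

lemma bounded_clinear_mult_right: "bounded_clinear (\<lambda>x::'a::complex_banach_algebra. a * x)"
  by (simp add: bounded_clinear_def bounded_linear_mult_right mult_scaleC_right)

lemma bounded_cbilinear_comp:
  assumes "bounded_cbilinear B" "bounded_clinear S" "bounded_clinear T"
  shows "bounded_cbilinear (\<lambda>x y. B (S x) (T y))"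
  using assms bounded_bilinear.comp [of B S T]
  by (simp add: bounded_cbilinear_def bounded_clinear_def)

text \<open>The actions of an algebra \<open>A\<close> on the dual and the bidual of an \<open>A\<close>-bimodule \<open>E\<close>, which is given
  by its left action \<open>l\<close> and its right action \<open>r\<close>: for a functional \<open>f\<close> on \<open>E\<close>,
  \<open>(a \<cdot> f)(x) = f (x \<cdot> a)\<close> and \<open>(f \<cdot> a)(x) = f (a \<cdot> x)\<close>.\<close>

definition dual_left :: "('e::complex_normed_vector \<Rightarrow> 'a \<Rightarrow> 'e) \<Rightarrow> 'a \<Rightarrow> 'e dual \<Rightarrow> 'e dual"
  where "dual_left r a f = dual_map (\<lambda>x. r x a) f"

definition dual_right :: "('a \<Rightarrow> 'e::complex_normed_vector \<Rightarrow> 'e) \<Rightarrow> 'e dual \<Rightarrow> 'a \<Rightarrow> 'e dual"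
  where "dual_right l f a = dual_map (l a) f"

definition bidual_left :: "('a \<Rightarrow> 'e::complex_normed_vector \<Rightarrow> 'e) \<Rightarrow> 'a \<Rightarrow> 'e dual dual \<Rightarrow> 'e dual dual"
  where "bidual_left l = dual_left (dual_right l)"

definition bidual_right :: "('e::complex_normed_vector \<Rightarrow> 'a \<Rightarrow> 'e) \<Rightarrow> 'e dual dual \<Rightarrow> 'a \<Rightarrow> 'e dual dual"
  where "bidual_right r = dual_right (dual_left r)"

definition ptensor_left ::
    "'a::complex_banach_algebra \<Rightarrow> ('a, 'a) ptensor \<Rightarrow> ('a, 'a) ptensor"
  where "ptensor_left a = tensor_lift (\<lambda>b c. (a * b) \<otimes>\<^sub>p c)"

definition ptensor_right ::
    "('a::complex_banach_algebra, 'a) ptensor \<Rightarrow> 'a \<Rightarrow> ('a, 'a) ptensor"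
  where "ptensor_right u a = tensor_lift (\<lambda>b c. b \<otimes>\<^sub>p (c * a)) u"

definition product_map :: "('a::complex_banach_algebra, 'a) ptensor \<Rightarrow> 'a"
  where "product_map = tensor_lift (*)"

lemma ptensor_left:
  "bounded_clinear (ptensor_left a)" "ptensor_left a (b \<otimes>\<^sub>p c) = (a * b) \<otimes>\<^sub>p c"
  using tensor_lift [OF bounded_cbilinear_comp [OF bounded_cbilinear_tensor
        bounded_clinear_mult_right [of a] bounded_clinear_ident]]
  by (simp_all add: ptensor_left_def)

lemma ptensor_right:
  "bounded_clinear (\<lambda>u. ptensor_right u a)" "ptensor_right (b \<otimes>\<^sub>p c) a = b \<otimes>\<^sub>p (c * a)"
  using tensor_lift [OF bounded_cbilinear_comp [OF bounded_cbilinear_tensor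
        bounded_clinear_ident bounded_clinear_mult_left [of a]]]
  by (simp_all add: ptensor_right_def)

lemma product_map: "bounded_clinear product_map" "product_map (a \<otimes>\<^sub>p b) = a * b"
  using tensor_lift [OF bounded_cbilinear_mult] by (simp_all add: product_map_def)

text \<open>A net is rendered by a filter: a net yields the filter generated by the images of its tails.
  That no generality is lost or gained is shown by
  \<open>johnson_pseudo_contractible_if_net\<close> and \<open>net_if_johnson_pseudo_contractible\<close> below.\<close>

definition johnson_pseudo_contractible :: "'a::complex_banach_algebra itself \<Rightarrow> bool"
  where "johnson_pseudo_contractible (_ :: 'a itself) \<longleftrightarrow>
    (\<exists>F :: ('a, 'a) ptensor dual dual filter. F \<noteq> bot \<and>
      (\<forall>\<^sub>F m in F. \<forall>a. bidual_left ptensor_left a m = bidual_right ptensor_right m a) \<and>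
      (\<forall>a. ((\<lambda>m. bidual_right (*) (dual_map (dual_map product_map) m) a - to_bidual a) \<longlongrightarrow> 0) F))"

lemma johnson_pseudo_contractible_if_net:
  fixes I :: "'i set" and le :: "'i \<Rightarrow> 'i \<Rightarrow> bool"
    and m :: "'i \<Rightarrow> ('a::complex_banach_algebra, 'a) ptensor dual dual"
  assumes ne: "I \<noteq> {}"
    and trans: "\<And>i j k. i \<in> I \<Longrightarrow> j \<in> I \<Longrightarrow> k \<in> I \<Longrightarrow> le i j \<Longrightarrow> le j k \<Longrightarrow> le i k"
    and dir: "\<And>i j. i \<in> I \<Longrightarrow> j \<in> I \<Longrightarrow> \<exists>k\<in>I. le i k \<and> le j k"
    and comm: "\<And>i a. i \<in> I \<Longrightarrow> bidual_left ptensor_left a (m i) = bidual_right ptensor_right (m i) a"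
    and lim: "\<And>a e. e > 0 \<Longrightarrow> \<exists>i\<^sub>0\<in>I. \<forall>i\<in>I. le i\<^sub>0 i \<longrightarrow>
      norm (bidual_right (*) (dual_map (dual_map product_map) (m i)) a - to_bidual a) < e"
  shows "johnson_pseudo_contractible TYPE('a)"
proof -
  define F where "F = (INF i\<in>I. principal (m ` {j\<in>I. le i j}))"
  have ev: "eventually P F \<longleftrightarrow> (\<exists>i\<in>I. \<forall>j\<in>I. le i j \<longrightarrow> P (m j))" for P
  proof -
    have "eventually P F \<longleftrightarrow> (\<exists>i\<in>I. eventually P (principal (m ` {j\<in>I. le i j})))"
      unfolding F_def
    proof (rule eventually_INF_base [OF ne])
      fix i j assume ij: "i \<in> I" "j \<in> I"
      then obtain k where "k \<in> I" "le i k" "le j k" using dir by blast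
      then show "\<exists>x\<in>I. principal (m ` {j\<in>I. le x j}) \<le>
          inf (principal (m ` {k\<in>I. le i k})) (principal (m ` {k\<in>I. le j k}))"
        using trans [OF ij(1), of k] trans [OF ij(2), of k]
        by (intro bexI [of _ k]) (auto simp only: inf_principal principal_le_iff)
    qed
    also have "\<dots> \<longleftrightarrow> (\<exists>i\<in>I. \<forall>j\<in>I. le i j \<longrightarrow> P (m j))"
      by (simp add: eventually_principal) blast
    finally show ?thesis .
  qed
  have "\<not> eventually (\<lambda>_. False) F"
    unfolding ev using dir by blast
  then have "F \<noteq> bot" by auto
  moreover have "\<forall>\<^sub>F m in F. \<forall>a. bidual_left ptensor_left a m = bidual_right ptensor_right m a"
    unfolding ev using ne comm by blast
  moreover have "((\<lambda>m. bidual_right (*) (dual_map (dual_map product_map) m) a - to_bidual a) \<longlongrightarrow> 0) F" for a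
    unfolding tendsto_iff ev dist_norm diff_zero using lim by blast
  ultimately show ?thesis
    unfolding johnson_pseudo_contractible_def by blast
qed

lemma net_if_johnson_pseudo_contractible:
  assumes "johnson_pseudo_contractible TYPE('a::complex_banach_algebra)"
  shows "\<exists>(I :: (('a, 'a) ptensor dual dual set \<times> ('a, 'a) ptensor dual dual) set) le m.
    I \<noteq> {} \<and> (\<forall>i\<in>I. le i i) \<and> (\<forall>i\<in>I. \<forall>j\<in>I. \<forall>k\<in>I. le i j \<longrightarrow> le j k \<longrightarrow> le i k) \<and>
    (\<forall>i\<in>I. \<forall>j\<in>I. \<exists>k\<in>I. le i k \<and> le j k) \<and>
    (\<forall>i\<in>I. \<forall>a::'a. bidual_left ptensor_left a (m i) = bidual_right ptensor_right (m i) a) \<and>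
    (\<forall>a. \<forall>e>0. \<exists>i\<^sub>0\<in>I. \<forall>i\<in>I. le i\<^sub>0 i \<longrightarrow>
      norm (bidual_right (*) (dual_map (dual_map product_map) (m i)) a - to_bidual a) < e)"
proof -
  define comm where
    "comm m \<longleftrightarrow> (\<forall>a::'a. bidual_left ptensor_left a m = bidual_right ptensor_right m a)" for m
  define d where
    "d m a = norm (bidual_right (*) (dual_map (dual_map product_map) m) a - to_bidual a)" for m and a :: 'a
  obtain F where F1: "F \<noteq> bot"
    and "\<forall>\<^sub>F m in F. \<forall>a::'a. bidual_left ptensor_left a m = bidual_right ptensor_right m a"
    and lim: "\<And>a. ((\<lambda>m. bidual_right (*) (dual_map (dual_map product_map) m) a - to_bidual a) \<longlongrightarrow> 0) F"
    using assms unfolding johnson_pseudo_contractible_def by blast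
  then have F2: "\<forall>\<^sub>F m in F. comm m" by (simp only: comm_def)
  have F3: "\<forall>\<^sub>F m in F. d m a < e" if "e > 0" for a e
    using tendstoD [OF lim that, of a] by (simp only: d_def dist_norm diff_zero)
  define I where "I = {(U, m). (\<forall>\<^sub>F x in F. x \<in> U) \<and> m \<in> U \<and> comm m}"
  have point: "\<exists>m. (U, m) \<in> I" if "\<forall>\<^sub>F x in F. x \<in> U" for U
    using eventually_happens' [OF F1 eventually_conj [OF that F2]] that unfolding I_def by blast
  have "I \<noteq> {}" using point [of UNIV] by auto
  moreover have "\<exists>k\<in>I. fst k \<subseteq> fst i \<and> fst k \<subseteq> fst j" if "i \<in> I" "j \<in> I" for i j
  proof -
    have "\<forall>\<^sub>F x in F. x \<in> fst i \<inter> fst j"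
      using that by (auto simp: I_def eventually_conj_iff)
    then obtain m where "(fst i \<inter> fst j, m) \<in> I" using point by blast
    then show ?thesis by (intro bexI [of _ "(fst i \<inter> fst j, m)"]) auto
  qed
  moreover have "comm (snd i)" if "i \<in> I" for i
    using that by (auto simp: I_def)
  moreover have "\<exists>i\<^sub>0\<in>I. \<forall>i\<in>I. fst i \<subseteq> fst i\<^sub>0 \<longrightarrow> d (snd i) a < e" if "e > 0" for a e
  proof -
    have "\<forall>\<^sub>F m in F. m \<in> {m. d m a < e}" using F3 [OF that, of a] by simp
    then obtain m where m: "({m. d m a < e}, m) \<in> I" using point by blast
    show ?thesis by (rule bexI [OF _ m]) (auto simp: I_def)
  qed
  ultimately show ?thesis
    unfolding comm_def d_def
    by (intro exI [of _ I] exI [of _ "\<lambda>i j. fst j \<subseteq> fst i"] exI [of _ snd] conjI ballI allI impI)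
      (blast | assumption)+
qed

section \<open>The bicyclic semigroup\<close>

inductive_set generated_semigroup :: "'s::semigroup_mult set \<Rightarrow> 's set" for X
  where
    generator: "x \<in> X \<Longrightarrow> x \<in> generated_semigroup X"
  | mult: "x \<in> generated_semigroup X \<Longrightarrow> y \<in> generated_semigroup X \<Longrightarrow> x * y \<in> generated_semigroup X"

definition bicyclic :: "'s::semigroup_mult \<Rightarrow> 's \<Rightarrow> 's \<Rightarrow> bool"
  where "bicyclic e p q \<longleftrightarrow>
    (\<forall>s. e * s = s \<and> s * e = s) \<and> generated_semigroup {p, q} = UNIV \<and> p * q = e \<and> e \<noteq> q * p"

end

(* An element m of the bidual of the projective tensor square with s . m = m . s acts on the
   bounded functions on S x S like a finitely additive measure of finite total variation on S x S,
   whose images under (x, y) -> (s x, y) and (x, y) -> (x, y s) coincide.  Let D be the set of pairs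
   with x y = e; if the image of m under the product is close to the point mass at e, then
   m(D) is close to 1.  As q^n is left cancellable, the invariance under q^n, applied to the set of
   all (q^n z, y) with z y = e, says that W_n = {(q^n z, y) | z y q^n = e} has the same measure
   as D.  Since e is not of the form q v, the sets W_n are pairwise disjoint, so that the
   variation of m is infinite. *)

theory Submission
  imports Defs
begin

section \<open>Functionals on the tensor square given by sets of pairs\<close>

text \<open>The bilinear form given by the indicator function of \<open>W\<close>, when bounded
  functions on pairs are regarded as functionals on the projective tensor product.\<close>

definition pair_sum :: "('s \<times> 't) set \<Rightarrow> 's ell1 \<Rightarrow> 't ell1 \<Rightarrow> complex"
  where "pair_sum W f g = (\<Sum>\<^sub>\<infinity>(r, s)\<in>W. ell1_apply f r * ell1_apply g s)"

text \<open>Restricting to \<open>W\<close> only drops terms from a nonnegative double series whose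
  total is the product of the norms; hence one constant serves all \<open>W\<close>.\<close>

lemma norm_pair_sum_le: "cmod (pair_sum W f g) \<le> norm f * norm g"
proof -
  define h where "h = (\<lambda>(r, s). cmod (ell1_apply f r * ell1_apply g s))"
  have h: "h summable_on A" for A
    unfolding h_def by (rule ell1_product_summable_on(2))
  have "cmod (pair_sum W f g) \<le> (\<Sum>\<^sub>\<infinity>i\<in>W. h i)"
    using norm_infsum_bound [of "\<lambda>(r, s). ell1_apply f r * ell1_apply g s" W] h [of W]
    by (simp add: pair_sum_def h_def case_prod_unfold)
  also have "\<dots> \<le> (\<Sum>\<^sub>\<infinity>i. h i)"
    by (rule infsum_mono_neutral [OF h h]) (auto simp: h_def)
  also have "\<dots> = (\<Sum>\<^sub>\<infinity>r. \<Sum>\<^sub>\<infinity>s. h (r, s))"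
    using infsum_Sigma_banach [of h UNIV "\<lambda>_. UNIV"] h by simp
  also have "\<dots> = norm f * norm g"
    by (simp add: h_def norm_mult infsum_cmult_right' infsum_cmult_left' norm_ell1.rep_eq)
  finally show ?thesis .
qed

lemma bounded_cbilinear_pair_sum: "bounded_cbilinear (pair_sum W)"
proof -
  note [simp] = pair_sum_def plus_ell1.rep_eq scaleR_ell1.rep_eq scaleC_ell1.rep_eq case_prod_unfold
  have sm: "(\<lambda>p. ell1_apply f (fst p) * ell1_apply g (snd p)) summable_on W"
    for f :: "'a ell1" and g :: "'b ell1"
    using ell1_product_summable_on(1) [of f g W] by simp
  have "bounded_bilinear (pair_sum W)"
  proof
    fix f f' :: "'a ell1" and g g' :: "'b ell1" and r :: real
    show "pair_sum W (f + f') g = pair_sum W f g + pair_sum W f' g"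
      by (simp add: distrib_right infsum_add sm)
    show "pair_sum W f (g + g') = pair_sum W f g + pair_sum W f g'"
      by (simp add: distrib_left infsum_add sm)
    show "pair_sum W (r *\<^sub>R f) g = r *\<^sub>R pair_sum W f g"
      by (simp add: scaleR_conv_of_real mult.assoc infsum_cmult_right')
    show "pair_sum W f (r *\<^sub>R g) = r *\<^sub>R pair_sum W f g"
      by (simp add: scaleR_conv_of_real mult.left_commute [of _ "complex_of_real r"] infsum_cmult_right')
    show "\<exists>K. \<forall>f g. cmod (pair_sum W f g) \<le> norm f * norm g * K"
      by (rule exI [of _ 1]) (use norm_pair_sum_le in auto)
  qed
  moreover have "pair_sum W (c *\<^sub>C f) g = c *\<^sub>C pair_sum W f g"
    and "pair_sum W f (c *\<^sub>C g) = c *\<^sub>C pair_sum W f g" for c f g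
    by (simp_all add: mult.assoc mult.left_commute [of _ c] infsum_cmult_right')
  ultimately show ?thesis by (simp only: bounded_cbilinear_def) blast
qed

lemma pair_sum_UN_disjoint:
  assumes "finite I" and disj: "disjoint_family_on W I"
  shows "pair_sum (\<Union>n\<in>I. W n) f g = (\<Sum>n\<in>I. pair_sum (W n) f g)"
  using assms
proof (induction I rule: finite_induct)
  case empty
  show ?case by (simp add: pair_sum_def)
next
  case (insert i I)
  have "W i \<inter> (\<Union>n\<in>I. W n) = {}"
    using insert.hyps insert.prems by (fastforce simp: disjoint_family_on_def)
  then have "pair_sum (\<Union>n\<in>insert i I. W n) f g = pair_sum (W i) f g + pair_sum (\<Union>n\<in>I. W n) f g"
    unfolding pair_sum_def UN_insert
    by (intro infsum_Un_disjoint ell1_product_summable_on(1))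
  then show ?case
    using insert by (simp add: disjoint_family_on_mono [of I "insert i I"] subset_insertI)
qed

definition pair_dual :: "('s \<times> 't) set \<Rightarrow> ('s ell1, 't ell1) ptensor dual"
  where "pair_dual W = Abs_dual (tensor_lift (pair_sum W))"

lemma pair_dual_apply: "dual_apply (pair_dual W) = tensor_lift (pair_sum W)"
  unfolding pair_dual_def
  by (intro dual_apply_Abs bounded_clinear_tensor_lift bounded_cbilinear_pair_sum)

lemma pair_dual_tensor: "dual_apply (pair_dual W) (f \<otimes>\<^sub>p g) = pair_sum W f g"
  by (simp add: pair_dual_apply tensor_lift_tensor bounded_cbilinear_pair_sum)

lemma ptensor_dual_eqI:
  assumes "\<And>f g. dual_apply \<phi> (f \<otimes>\<^sub>p g) = dual_apply \<psi> (f \<otimes>\<^sub>p g)"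
  shows "\<phi> = \<psi>"
  using tensor_ext [OF bounded_clinear_bounded_linear [OF dual_bounded_clinear]
      bounded_clinear_bounded_linear [OF dual_bounded_clinear] assms]
  by (simp add: dual_apply_inject)

text \<open>The specification of \<open>tensor_lift\<close> carries no explicit constant, so the
  functional is identified with the map from \<open>tensor_factor\<close> for the constant 1.
  Uniformity in \<open>W\<close> is what later bounds the variation of a bidual element.\<close>

lemma norm_pair_dual_le: "norm (pair_dual W) \<le> 1"
proof (rule dual_norm_bound)
  obtain T where T: "bounded_clinear T" "\<And>f g. T (f \<otimes>\<^sub>p g) = pair_sum W f g"
    and nT: "\<And>u. norm (T u) \<le> 1 * norm u"
    using tensor_factor [OF bounded_cbilinear_pair_sum, of 1 W] norm_pair_sum_le [of W]
    by (auto simp: mult_1_left)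
  have "dual_apply (pair_dual W) = T"
    by (rule tensor_ext)
      (simp_all add: T pair_dual_tensor bounded_clinear_bounded_linear dual_bounded_clinear)
  then show "cmod (dual_apply (pair_dual W) u) \<le> 1 * norm u" for u
    using nT by simp
qed simp

lemma dual_apply_sum: "dual_apply (\<Sum>n\<in>I. \<phi> n) x = (\<Sum>n\<in>I. dual_apply (\<phi> n) x)"
  by (induction I rule: infinite_finite_induct) (simp_all add: zero_dual.rep_eq plus_dual.rep_eq)

text \<open>This makes every bidual element a finitely additive measure on sets of pairs.\<close>

lemma pair_dual_UN_disjoint:
  assumes "finite I" "disjoint_family_on W I"
  shows "pair_dual (\<Union>n\<in>I. W n) = (\<Sum>n\<in>I. pair_dual (W n))"
  by (rule ptensor_dual_eqI)
    (simp add: dual_apply_sum pair_dual_tensor pair_sum_UN_disjoint [OF assms])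

section \<open>Multiplication by point masses\<close>

text \<open>Only pairs with first entry \<open>s\<close> contribute to the convolution. The fibre
  can have several points, since multiplication by \<open>s\<close> need not be injective.\<close>

lemma ell1_apply_delta_mult:
  "ell1_apply (ell1_delta s * f) t = (\<Sum>\<^sub>\<infinity>r\<in>{r. s * r = t}. ell1_apply f r)"
proof -
  have "ell1_apply (ell1_delta s * f) t = (\<Sum>\<^sub>\<infinity>p\<in>Pair s ` {r. s * r = t}. ell1_apply f (snd p))"
    unfolding ell1_apply_times ell1_delta.rep_eq
    by (rule infsum_cong_neutral) (auto simp: image_iff)
  then show ?thesis
    by (simp add: infsum_reindex inj_on_def o_def)
qed

lemma ell1_apply_mult_delta:
  "ell1_apply (f * ell1_delta s) t = (\<Sum>\<^sub>\<infinity>r\<in>{r. r * s = t}. ell1_apply f r)"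
proof -
  have "ell1_apply (f * ell1_delta s) t =
      (\<Sum>\<^sub>\<infinity>p\<in>(\<lambda>r. (r, s)) ` {r. r * s = t}. ell1_apply f (fst p))"
    unfolding ell1_apply_times ell1_delta.rep_eq
    by (rule infsum_cong_neutral) (auto simp: image_iff)
  then show ?thesis
    by (simp add: infsum_reindex inj_on_def o_def)
qed

text \<open>The left side integrates the indicator of \<open>W\<close> against an image measure.
  Grouping the sum over the preimage of \<open>W\<close> by the fibres of (x, y) \<mapsto> (s x, y)
  gives the right side.\<close>

lemma pair_sum_delta_left:
  fixes W :: "('s::semigroup_mult \<times> 't) set"
  shows "pair_sum W (ell1_delta s * f) g = pair_sum {(x, y). (s * x, y) \<in> W} f g"
proof -
  define A where "A = {(x, y). (s * x, y) \<in> W}"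
  define h where "h = (\<lambda>(r, y). ell1_apply f r * ell1_apply g y)"
  define p where "p = (\<lambda>(x :: 's, y :: 't). (s * x, y))"
  have "pair_sum W (ell1_delta s * f) g = (\<Sum>\<^sub>\<infinity>t\<in>W. \<Sum>\<^sub>\<infinity>i\<in>{i\<in>A. p i = t}. h i)"
    unfolding pair_sum_def
  proof (rule infsum_cong)
    fix t assume t: "t \<in> W"
    obtain a b where ab: "t = (a, b)" by force
    have img: "{i\<in>A. p i = t} = (\<lambda>r. (r, b)) ` {r. s * r = a}"
      using t by (auto simp: ab A_def p_def)
    show "(case t of (r, y) \<Rightarrow> ell1_apply (ell1_delta s * f) r * ell1_apply g y) =
        (\<Sum>\<^sub>\<infinity>i\<in>{i\<in>A. p i = t}. h i)"
      unfolding img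
      by (simp add: ab infsum_reindex inj_on_def o_def h_def infsum_cmult_left' ell1_apply_delta_mult)
  qed
  also have "\<dots> = (\<Sum>\<^sub>\<infinity>i\<in>A. h i)"
    by (rule infsum_fibres_eq) (auto simp: h_def A_def p_def ell1_product_summable_on(1))
  finally show ?thesis by (simp add: pair_sum_def A_def h_def)
qed

lemma pair_sum_delta_right:
  fixes W :: "('s \<times> 't::semigroup_mult) set"
  shows "pair_sum W f (g * ell1_delta s) = pair_sum {(x, y). (x, y * s) \<in> W} f g"
proof -
  define A where "A = {(x, y). (x, y * s) \<in> W}"
  define h where "h = (\<lambda>(r, y). ell1_apply f r * ell1_apply g y)"
  define p where "p = (\<lambda>(x :: 's, y :: 't). (x, y * s))"
  have "pair_sum W f (g * ell1_delta s) = (\<Sum>\<^sub>\<infinity>t\<in>W. \<Sum>\<^sub>\<infinity>i\<in>{i\<in>A. p i = t}. h i)"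
    unfolding pair_sum_def
  proof (rule infsum_cong)
    fix t assume t: "t \<in> W"
    obtain a b where ab: "t = (a, b)" by force
    have img: "{i\<in>A. p i = t} = Pair a ` {r. r * s = b}"
      using t by (auto simp: ab A_def p_def)
    show "(case t of (r, y) \<Rightarrow> ell1_apply f r * ell1_apply (g * ell1_delta s) y) =
        (\<Sum>\<^sub>\<infinity>i\<in>{i\<in>A. p i = t}. h i)"
      unfolding img
      by (simp add: ab infsum_reindex inj_on_def o_def h_def infsum_cmult_right' ell1_apply_mult_delta)
  qed
  also have "\<dots> = (\<Sum>\<^sub>\<infinity>i\<in>A. h i)"
    by (rule infsum_fibres_eq) (auto simp: h_def A_def p_def ell1_product_summable_on(1))
  finally show ?thesis by (simp add: pair_sum_def A_def h_def)
qed

section \<open>Transposed module actions and coordinate functionals\<close>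

lemma dual_map_ptensor_left_pair_dual:
  "dual_map (ptensor_left (ell1_delta s)) (pair_dual W) = pair_dual {(x, y). (s * x, y) \<in> W}"
  by (rule ptensor_dual_eqI)
    (simp add: dual_map_apply ptensor_left pair_dual_tensor pair_sum_delta_left)

lemma dual_map_ptensor_right_pair_dual:
  "dual_map (\<lambda>u. ptensor_right u (ell1_delta s)) (pair_dual W) = pair_dual {(x, y). (x, y * s) \<in> W}"
  by (rule ptensor_dual_eqI)
    (simp add: dual_map_apply ptensor_right pair_dual_tensor pair_sum_delta_right)

lemma bounded_clinear_ell1_apply: "bounded_clinear (\<lambda>f. ell1_apply f t)"
  by (simp add: bounded_clinear_def scaleC_ell1.rep_eq)
    (rule bounded_linear_intro [where K = 1];
      simp add: plus_ell1.rep_eq scaleR_ell1.rep_eq ell1_apply_le)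

definition coordinate_dual :: "'s \<Rightarrow> 's ell1 dual"
  where "coordinate_dual t = Abs_dual (\<lambda>f. ell1_apply f t)"

lemma coordinate_dual_apply: "dual_apply (coordinate_dual t) f = ell1_apply f t"
  by (simp add: coordinate_dual_def dual_apply_Abs bounded_clinear_ell1_apply)

lemma norm_coordinate_dual_le: "norm (coordinate_dual t) \<le> 1"
  by (rule dual_norm_bound) (simp_all add: coordinate_dual_apply ell1_apply_le)

lemma dual_map_product_map_coordinate_dual:
  "dual_map product_map (coordinate_dual t) = pair_dual {(x, y). x * y = t}"
  by (rule ptensor_dual_eqI)
    (simp add: dual_map_apply product_map coordinate_dual_apply pair_dual_tensor ell1_apply_times
      pair_sum_def)

text \<open>The invariance of the measure. Both values come from evaluating the bidual actions at
  \<open>pair_dual W\<close>: these actions are transposed twice, so they compose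
  \<open>pair_dual W\<close> with multiplication by the point mass.\<close>

lemma central_bidual_pair_dual:
  fixes m :: "('s::semigroup_mult ell1, 's ell1) ptensor dual dual"
  assumes "bidual_left ptensor_left (ell1_delta s) m = bidual_right ptensor_right m (ell1_delta s)"
  shows "dual_apply m (pair_dual {(x, y). (s * x, y) \<in> W}) =
    dual_apply m (pair_dual {(x, y). (x, y * s) \<in> W})"
proof -
  have "dual_apply (bidual_left ptensor_left (ell1_delta s) m) (pair_dual W) =
      dual_apply m (pair_dual {(x, y). (s * x, y) \<in> W})"
    by (simp add: bidual_left_def dual_left_def dual_right_def dual_map_apply
        bounded_clinear_dual_map ptensor_left dual_map_ptensor_left_pair_dual)
  moreover have "dual_apply (bidual_right ptensor_right m (ell1_delta s)) (pair_dual W) =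
      dual_apply m (pair_dual {(x, y). (x, y * s) \<in> W})"
    by (simp add: bidual_right_def dual_left_def [abs_def] dual_right_def dual_map_apply
        bounded_clinear_dual_map ptensor_right dual_map_ptensor_right_pair_dual)
  ultimately show ?thesis using assms by simp
qed

text \<open>Right multiplication by \<open>ell1_delta e\<close> fixes the coordinate functional, so
  only its pullback along the product map remains.\<close>

lemma bidual_product_coordinate:
  fixes m :: "('s::semigroup_mult ell1, 's ell1) ptensor dual dual"
  assumes e: "\<And>s. s * e = s"
  shows "dual_apply (bidual_right (*) (dual_map (dual_map product_map) m) (ell1_delta e))
      (coordinate_dual t) = dual_apply m (pair_dual {(x, y). x * y = t})"
proof -
  have "f * ell1_delta e = f" for f :: "'s ell1"
    by (rule ell1_eqI) (simp add: ell1_apply_mult_delta e)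
  then have "dual_map (\<lambda>f. f * ell1_delta e) (coordinate_dual t) = coordinate_dual t"
    by (simp add: dual_apply_inject [symmetric] fun_eq_iff dual_map_apply bounded_clinear_ident)
  then show ?thesis
    by (simp add: bidual_right_def dual_left_def [abs_def] dual_right_def dual_map_apply
        bounded_clinear_dual_map bounded_clinear_mult_left product_map
        dual_map_product_map_coordinate_dual)
qed

section \<open>Disjoint translates in the bicyclic semigroup\<close>

text \<open>For \<open>s\<close> the n-th power of \<open>q\<close> this is the set W_n of the
  opening comment.\<close>

definition power_translate :: "'s::semigroup_mult \<Rightarrow> 's \<Rightarrow> ('s \<times> 's) set"
  where "power_translate e s = {(x, y). \<exists>z. x = s * z \<and> z * (y * s) = e}"

lemma central_bidual_power_translate:
  fixes m :: "('s::semigroup_mult ell1, 's ell1) ptensor dual dual"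
  assumes comm: "bidual_left ptensor_left (ell1_delta s) m = bidual_right ptensor_right m (ell1_delta s)"
    and canc: "\<And>x z. s * x = s * z \<Longrightarrow> x = z"
  shows "dual_apply m (pair_dual (power_translate e s)) = dual_apply m (pair_dual {(x, y). x * y = e})"
proof -
  \<comment> \<open>The test set for invariance: by cancellation its preimage under left
    multiplication is the set of pairs with product \<open>e\<close>, while its preimage under right
    multiplication is the translate.\<close>
  define Z where "Z = {(x, y). \<exists>z. x = s * z \<and> z * y = e}"
  have "{(x, y). (s * x, y) \<in> Z} = {(x, y). x * y = e}"
    unfolding Z_def by (auto dest: canc)
  moreover have "{(x, y). (x, y * s) \<in> Z} = power_translate e s"
    by (auto simp: Z_def power_translate_def)
  ultimately show ?thesis
    using central_bidual_pair_dual [OF comm, of Z] by simp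
qed

(* A semigroup has no zeroth power, so the n-th power of q is built from the identity e. *)
lemma bicyclic_powers:
  fixes e p q :: "'s::semigroup_mult"
  assumes "bicyclic e p q"
  obtains Q :: "nat \<Rightarrow> 's" where
    "\<And>n x z. Q n * x = Q n * z \<Longrightarrow> x = z"
    "disjoint_family (\<lambda>n. power_translate e (Q n))"
proof -
  have e [simp]: "e * s = s" "s * e = s" for s
    using assms by (auto simp: bicyclic_def)
  have pq: "p * q = e" and qp: "e \<noteq> q * p"
    using assms by (auto simp: bicyclic_def)
  \<comment> \<open>\<open>P\<close> grows on the left and \<open>Q\<close> on the right, so the
    inner product collapses to \<open>e\<close> by induction. Thus \<open>P n\<close> is a left
    inverse of \<open>Q n\<close>, which gives cancellation.\<close>
  define P where "P n = ((*) p ^^ n) e" for n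
  define Q where "Q n = ((\<lambda>x. x * q) ^^ n) e" for n
  have PQ: "P n * Q n = e" for n
  proof (induction n)
    case (Suc n)
    have "P (Suc n) * Q (Suc n) = p * (P n * Q n) * q"
      by (simp add: P_def Q_def mult.assoc)
    then show ?case by (simp add: Suc pq)
  qed (simp add: P_def Q_def)
  have canc: "x = z" if "Q n * x = Q n * z" for n x z
  proof -
    have "P n * Q n * x = P n * Q n * z" using that by (simp add: mult.assoc)
    then show ?thesis by (simp add: PQ)
  qed
  have Q_add: "Q (n + k) = Q n * Q k" for n k
    by (induction k) (simp_all add: Q_def mult.assoc [symmetric])
  have disj: "power_translate e (Q n) \<inter> power_translate e (Q m) = {}" if nm: "n < m" for n m
  proof (rule ccontr)
    assume "power_translate e (Q n) \<inter> power_translate e (Q m) \<noteq> {}"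
    then obtain y z w where eq: "Q n * z = Q m * w" and z: "z * (y * Q n) = e"
      by (auto simp: power_translate_def)
    \<comment> \<open>Writing the positive gap as \<open>1 + k\<close> splits off one factor
      \<open>q\<close>. Cancelling \<open>Q n\<close> shows that \<open>z\<close>, and hence
      \<open>e\<close>, is a left multiple by \<open>q\<close>.\<close>
    obtain k where k: "m = n + (1 + k)" using less_imp_Suc_add [OF nm] by auto
    have "Q 1 = q" by (simp add: Q_def)
    then have "Q m = Q n * (q * Q k)" by (simp only: k Q_add)
    then have "z = q * (Q k * w)" using eq canc [of n] by (simp add: mult.assoc)
    then have "e = q * (Q k * w * (y * Q n))" using z by (metis mult.assoc)
    then obtain v where v: "e = q * v" ..
    \<comment> \<open>A right inverse of \<open>q\<close> must equal its left inverse
      \<open>p\<close>, contradicting \<open>qp\<close>.\<close>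
    have "v = p * q * v" by (simp add: pq)
    also have "\<dots> = p" by (simp add: mult.assoc flip: v)
    finally show False using v qp by metis
  qed
  show thesis
  proof (rule that [OF canc])
    show "disjoint_family (\<lambda>n. power_translate e (Q n))"
      unfolding disjoint_family_on_def using disj by (metis Int_commute nat_neq_iff)
  qed
qed

theorem mainTheorem2:
  fixes e p q :: "'s::semigroup_mult"
  assumes "bicyclic e p q"
  shows "\<not> johnson_pseudo_contractible TYPE('s ell1)"
proof
  assume "johnson_pseudo_contractible TYPE('s ell1)"
  then obtain F :: "('s ell1, 's ell1) ptensor dual dual filter" where "F \<noteq> bot"
    and comm: "\<forall>\<^sub>F m in F. \<forall>a. bidual_left ptensor_left a m = bidual_right ptensor_right m a"
    and lim: "\<And>a. ((\<lambda>m. bidual_right (*) (dual_map (dual_map product_map) m) a - to_bidual a) \<longlongrightarrow> 0) F"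
    unfolding johnson_pseudo_contractible_def by blast
  define d where "d m = bidual_right (*) (dual_map (dual_map product_map) m) (ell1_delta e) -
    to_bidual (ell1_delta e)" for m :: "('s ell1, 's ell1) ptensor dual dual"
  have "\<forall>\<^sub>F m in F. norm (d m) < 1 / 2"
    using tendstoD [OF lim [of "ell1_delta e"], of "1 / 2"] by (simp add: d_def dist_norm)
  \<comment> \<open>A single \<open>m\<close> yields the contradiction: it is central and close to
    the identity at \<open>ell1_delta e\<close>. The tolerance 1/2 keeps the value \<open>c\<close>
    away from 0.\<close>
  from eventually_happens' [OF \<open>F \<noteq> bot\<close> eventually_conj [OF comm this]]
  obtain m where comm: "\<And>a. bidual_left ptensor_left a m = bidual_right ptensor_right m a"
    and d: "norm (d m) < 1 / 2" by blast
  define c where "c = dual_apply m (pair_dual {(x, y). x * y = e})"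
  have "dual_apply (d m) (coordinate_dual e) = c - 1"
    unfolding d_def minus_dual.rep_eq c_def
    using assms by (subst bidual_product_coordinate)
      (simp_all add: bicyclic_def to_bidual_apply coordinate_dual_apply ell1_delta.rep_eq)
  then have "cmod (c - 1) \<le> norm (d m) * norm (coordinate_dual e)"
    by (metis dual_norm_le)
  also have "\<dots> \<le> norm (d m) * 1"
    by (intro mult_left_mono norm_coordinate_dual_le) simp
  finally have c: "cmod c \<ge> 1 / 2"
    using d norm_triangle_ineq2 [of 1 "1 - c"] by (simp add: norm_minus_commute)
  obtain Q :: "nat \<Rightarrow> 's" where canc: "\<And>n x z. Q n * x = Q n * z \<Longrightarrow> x = z"
    and disj: "disjoint_family (\<lambda>n. power_translate e (Q n))"
    using bicyclic_powers [OF assms] by blast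
  have m_lin: "linear (dual_apply m)"
    by (intro bounded_linear.linear bounded_clinear_bounded_linear dual_bounded_clinear)
  \<comment> \<open>The first \<open>N\<close> translates all have measure \<open>c\<close>, and the
    functional of their disjoint union still has norm at most 1.\<close>
  have bound: "real N * (1 / 2) \<le> norm m" for N
  proof -
    have "of_nat N * c = (\<Sum>n<N. dual_apply m (pair_dual (power_translate e (Q n))))"
      by (simp add: c_def central_bidual_power_translate [OF comm canc])
    also have "\<dots> = dual_apply m (pair_dual (\<Union>n<N. power_translate e (Q n)))"
      using disj by (subst pair_dual_UN_disjoint)
        (auto simp: linear_sum [OF m_lin] intro: disjoint_family_on_mono)
    finally have "real N * cmod c \<le> norm m * norm (pair_dual (\<Union>n<N. power_translate e (Q n)))"
      by (metis dual_norm_le norm_mult norm_of_nat)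
    also have "\<dots> \<le> norm m * 1"
      by (intro mult_left_mono norm_pair_dual_le) simp
    finally show ?thesis
      using mult_left_mono [OF c, of "real N"] by simp
  qed
  obtain N where "2 * norm m < real N" using reals_Archimedean2 by blast
  then show False using bound [of N] by simp
qed

end
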